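(* Let $(a_1,a_2)\in\mathbb{R}^2$ satisfy $a_1+a_2=1$ and $a_2\in(-1,1]$ (i.e. $(a_1,a_2)\in P\setminus\{(2,-1)\}$), and let $X$ be the AR(2)-process with coefficients $a_1,a_2$. Assume that $\mathbb{E}[Y_1]=0$ and $\mathbb{E}[e^{|Y_1|^\alpha}]<\infty$ for some $\alpha>0$. Then $$p_N = N^{-1/2+o(1)}\ \ (N\to\infty)\quad\text{if } |a_2|<1,\qquad p_N\asymp N^{-1}\quad\text{if } a_2=1 .$$
   Context: Let $(Y_n)_{n\ge1}$ be i.i.d. nondegenerate real random variables. For fixed $p\ge1$ and real coefficients $a_1,\dots,a_p$, the AR($p$)-process $X$ is defined by $X_n=\sum_{k=1}^p a_kX_{n-k}+Y_n$ for $n\ge1$, with the convention $X_n=0$ for $n\le0$. The survival probability is $p_N(x):=\mathbb{P}(\sup_{n=1,\dots,N}X_n\le x)$ for $N\ge1$, $x\ge0$, and $p_N:=p_N(0)$. $P:=\{(a_1,a_2): a_1+a_2=1,\ a_2\in[-1,1]\}$. For positive functions, $f\precsim g$ means $\limsup f/g<\infty$, and $f\asymp g$ means $f\precsim g$ and $g\precsim f$. *)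

theory Defs
  imports "HOL-Probability.Probability" "HOL-Library.Landau_Symbols"
begin

text \<open>AR(2) process: X_0 = 0 (and X_n = 0 for n \<le> 0),
  X_n = a1 X_(n-1) + a2 X_(n-2) + Y_n for n \<ge> 1. The innovations Y are indexed from 1.\<close>
fun ar2 :: "real \<Rightarrow> real \<Rightarrow> (nat \<Rightarrow> 'a \<Rightarrow> real) \<Rightarrow> nat \<Rightarrow> 'a \<Rightarrow> real" where
  "ar2 a1 a2 Y 0 \<omega> = 0"
| "ar2 a1 a2 Y (Suc 0) \<omega> = a1 * ar2 a1 a2 Y 0 \<omega> + Y 1 \<omega>"
| "ar2 a1 a2 Y (Suc (Suc n)) \<omega> =
     a1 * ar2 a1 a2 Y (Suc n) \<omega> + a2 * ar2 a1 a2 Y n \<omega> + Y (Suc (Suc n)) \<omega>"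

definition surv_prob :: "'a measure \<Rightarrow> (nat \<Rightarrow> 'a \<Rightarrow> real) \<Rightarrow> nat \<Rightarrow> real" where
  "surv_prob M X N = measure M {\<omega> \<in> space M. \<forall>n\<in>{1..N}. X n \<omega> \<le> 0}"

end

theory Submission
  imports Defs "HOL-Real_Asymp.Real_Asymp"
begin

text \<open>Put \<open>a = a2\<close> and let \<open>S n\<close> be the partial sums of the innovations. Since \<open>a1 + a2 = 1\<close>,
  \<open>X n + a * X (n - 1) = S n\<close>, so for \<open>a = 1\<close> the process consists of two independent copies of the
  walk \<open>S\<close> run at even and odd times, and for \<open>\<bar>a\<bar> < 1\<close> the difference \<open>(1 + a) * X n - S n\<close> is bounded by
  a constant times \<open>max \<bar>Y i\<bar>\<close>, which is polylogarithmic up to time \<open>N\<close>.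

  The walk stays nonpositive up to time \<open>n\<close> with probability of order \<open>1 / \<surd>n\<close>. Upper bound: optional
  stopping and time reversal express the expectation of \<open>- S n\<close> on survival through the
  renewal measure of the ladder heights, which grows linearly; hence it is bounded, and Harris'
  inequality combined with the central limit theorem gives the claim. Lower bound: decomposing at the
  location of the maximum gives \<open>1 \<le> (\<Sum>k\<le>n. r k * q (n - k))\<close> with the survival probabilities
  \<open>q\<close> and \<open>r\<close> of \<open>S\<close> and \<open>- S\<close>, and both satisfy the upper bound.

  For \<open>\<bar>a\<bar> < 1\<close> the process is a monotone function of the innovations. By Harris' inequality a
  polylogarithmic shift of the barrier changes the survival probability by a factor \<open>N powr o(1)\<close> only.\<close>

subsection \<open>Harris' inequality on sequence space\<close>

lemma chebyshev_association:
  fixes F G :: "real \<Rightarrow> real"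
  assumes "prob_space M" and [measurable]: "F \<in> borel_measurable M" "G \<in> borel_measurable M"
    and F: "\<And>x. 0 \<le> F x" "\<And>x. F x \<le> 1" and G: "\<And>x. 0 \<le> G x" "\<And>x. G x \<le> 1"
    and anti: "antimono F" "antimono G"
  shows "(\<integral>x. F x \<partial>M) * (\<integral>x. G x \<partial>M) \<le> (\<integral>x. F x * G x \<partial>M)"
proof -
  interpret prob_space M by fact
  have iF: "integrable M F" and iG: "integrable M G"
    by (intro integrable_const_bound[where B=1] AE_I2; simp add: F G)+
  have iFG: "integrable M (\<lambda>x. F x * G x)"
    by (intro integrable_const_bound[where B=1] AE_I2; simp add: F G abs_mult mult_le_one)
  have "0 \<le> expectation (\<lambda>y. (F x - F y) * (G x - G y))" for x
  proof (rule integral_nonneg_AE, rule AE_I2)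
    fix y
    show "0 \<le> (F x - F y) * (G x - G y)"
    proof (cases "x \<le> y")
      case True
      with anti have "F y \<le> F x" "G y \<le> G x" by (simp_all add: antimonoD)
      then show ?thesis by simp
    next
      case False
      with anti have "F x \<le> F y" "G x \<le> G y" by (simp_all add: antimonoD)
      then show ?thesis by (simp add: mult_nonpos_nonpos)
    qed
  qed
  moreover have "expectation (\<lambda>y. (F x - F y) * (G x - G y)) =
      F x * G x - F x * expectation G - G x * expectation F + expectation (\<lambda>y. F y * G y)" for x
    using iF iG iFG by (simp add: algebra_simps prob_space)
  ultimately have "0 \<le> expectation (\<lambda>x. F x * G x - F x * expectation G - G x * expectation F
      + expectation (\<lambda>y. F y * G y))"
    by (intro integral_nonneg_AE AE_I2) simp
  also have "\<dots> = 2 * expectation (\<lambda>x. F x * G x) - 2 * (expectation F * expectation G)"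
    using iF iG iFG by (simp add: algebra_simps prob_space)
  finally show ?thesis by simp
qed

definition antitone_upto :: "nat \<Rightarrow> ((nat \<Rightarrow> real) \<Rightarrow> 'b::order) \<Rightarrow> bool" where
  "antitone_upto n f \<longleftrightarrow> (\<forall>x y. (\<forall>i<n. x i \<le> y i) \<longrightarrow> f y \<le> f x)"

definition determined_upto :: "nat \<Rightarrow> ((nat \<Rightarrow> real) \<Rightarrow> 'b) \<Rightarrow> bool" where
  "determined_upto n f \<longleftrightarrow> (\<forall>x y. (\<forall>i<n. x i = y i) \<longrightarrow> f x = f y)"

lemma antitone_uptoD: "antitone_upto n f \<Longrightarrow> (\<And>i. i < n \<Longrightarrow> x i \<le> y i) \<Longrightarrow> f y \<le> f x"
  by (auto simp: antitone_upto_def)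

lemma antitone_upto_case_nat:
  assumes "antitone_upto (Suc n) f"
  shows "antitone_upto n (\<lambda>x. f (case_nat y x))"
  unfolding antitone_upto_def
proof (intro allI impI)
  fix x z :: "nat \<Rightarrow> real"
  assume "\<forall>i<n. x i \<le> z i"
  then show "f (case_nat y z) \<le> f (case_nat y x)"
    by (intro antitone_uptoD[OF assms]) (auto split: nat.split)
qed

locale real_sequence_space = sequence_space M for M :: "real measure" +
  assumes sets_M [measurable_cong, simp]: "sets M = sets borel"

lemma real_sequence_spaceI:
  "prob_space M \<Longrightarrow> sets M = sets borel \<Longrightarrow> real_sequence_space M"
  by (simp add: real_sequence_space_def real_sequence_space_axioms_def sequence_space_def
      product_prob_space_def product_prob_space_axioms_def product_sigma_finite_def
      prob_space_imp_sigma_finite)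

context real_sequence_space
begin

lemma space_M [simp]: "space M = UNIV"
  using sets_eq_imp_space_eq[OF sets_M] by simp

lemma space_S [simp]: "space S = UNIV"
  by (simp add: space_PiM)

lemma measurable_coord [measurable]: "(\<lambda>x. x i) \<in> borel_measurable S"
proof -
  have "(\<lambda>x. x i) \<in> measurable S M" by measurable
  then show ?thesis by simp
qed

lemma Collect_in_sets: "Measurable.pred S \<phi> \<Longrightarrow> {x. \<phi> x} \<in> sets S"
  by (drule predE) simp

lemma measurable_reindex: "(\<lambda>x i. x (\<pi> i)) \<in> measurable S S"
  by (rule measurable_PiM_single') auto

lemma distr_reindex:
  fixes \<pi> :: "nat \<Rightarrow> nat"
  assumes "inj \<pi>"
  shows "distr S S (\<lambda>x i. x (\<pi> i)) = S"
  using distr_PiM_reindex[of UNIV "\<lambda>_. M" \<pi> UNIV] assms M.prob_space_axioms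
  by (simp add: restrict_UNIV)

lemma prob_reindex:
  assumes "inj \<pi>" and [measurable]: "Measurable.pred S \<phi>"
  shows "P.prob {x. \<phi> (\<lambda>i. x (\<pi> i))} = P.prob {x. \<phi> x}"
proof -
  have "P.prob {x. \<phi> x} = measure (distr S S (\<lambda>x i. x (\<pi> i))) {x. \<phi> x}"
    by (simp add: distr_reindex assms)
  also have "\<dots> = P.prob {x. \<phi> (\<lambda>i. x (\<pi> i))}"
    by (subst measure_distr) (simp_all add: vimage_def Collect_in_sets measurable_reindex)
  finally show ?thesis ..
qed

lemma nn_integral_reindex:
  assumes "inj \<pi>" and [measurable]: "f \<in> borel_measurable S"
  shows "(\<integral>\<^sup>+x. f (\<lambda>i. x (\<pi> i)) \<partial>S) = (\<integral>\<^sup>+x. f x \<partial>S)"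
proof -
  have "(\<integral>\<^sup>+x. f x \<partial>S) = (\<integral>\<^sup>+x. f x \<partial>distr S S (\<lambda>x i. x (\<pi> i)))"
    by (simp add: distr_reindex assms)
  also have "\<dots> = (\<integral>\<^sup>+x. f (\<lambda>i. x (\<pi> i)) \<partial>S)"
    by (subst nn_integral_distr) (simp_all add: measurable_reindex)
  finally show ?thesis ..
qed

lemma prob_prefix_suffix:
  assumes [measurable]: "Measurable.pred S \<phi>" "Measurable.pred S \<psi>" and det: "determined_upto k \<phi>"
  shows "P.prob {x. \<phi> x \<and> \<psi> (\<lambda>i. x (i + k))} = P.prob {x. \<phi> x} * P.prob {x. \<psi> x}"
proof -
  have shift: "(\<lambda>i. comb_seq k x y (i + k)) = y" for x y :: "nat \<Rightarrow> real"
    by (auto simp: comb_seq_def)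
  have pre: "\<phi> (comb_seq k x y) = \<phi> x" for x y
    using det by (auto simp: determined_upto_def comb_seq_def)
  have "P.prob {x. \<phi> x \<and> \<psi> (\<lambda>i. x (i + k))} =
      measure (distr (S \<Otimes>\<^sub>M S) S (\<lambda>(x, y). comb_seq k x y)) {x. \<phi> x \<and> \<psi> (\<lambda>i. x (i + k))}"
    by (simp add: PiM_comb_seq)
  also have "\<dots> = measure (S \<Otimes>\<^sub>M S) ({x. \<phi> x} \<times> {x. \<psi> x})"
  proof (subst measure_distr)
    show "(\<lambda>(x, y). comb_seq k x y) \<in> S \<Otimes>\<^sub>M S \<rightarrow>\<^sub>M S" by (rule measurable_comb_seq)
    have [measurable]: "Measurable.pred S (\<lambda>x. \<psi> (\<lambda>i. x (i + k)))"
      by (rule measurable_compose[OF measurable_reindex]) simp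
    show "{x. \<phi> x \<and> \<psi> (\<lambda>i. x (i + k))} \<in> P.events" by (rule Collect_in_sets) measurable
    have "(\<lambda>(x, y). comb_seq k x y) -` {x. \<phi> x \<and> \<psi> (\<lambda>i. x (i + k))} \<inter> space (S \<Otimes>\<^sub>M S)
        = {x. \<phi> x} \<times> {x. \<psi> x}"
      by (auto simp: space_pair_measure shift pre)
    then show "measure (S \<Otimes>\<^sub>M S) ((\<lambda>(x, y). comb_seq k x y) -` {x. \<phi> x \<and> \<psi> (\<lambda>i. x (i + k))}
        \<inter> space (S \<Otimes>\<^sub>M S)) = measure (S \<Otimes>\<^sub>M S) ({x. \<phi> x} \<times> {x. \<psi> x})" by simp
  qed
  also have "\<dots> = P.prob {x. \<phi> x} * P.prob {x. \<psi> x}"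
    by (simp add: measure_def P.emeasure_pair_measure_Times Collect_in_sets enn2real_mult)
  finally show ?thesis .
qed

lemma nn_integral_head:
  assumes [measurable]: "f \<in> borel_measurable S"
  shows "(\<integral>\<^sup>+x. f x \<partial>S) = (\<integral>\<^sup>+y. (\<integral>\<^sup>+x. f (case_nat y x) \<partial>S) \<partial>M)"
proof -
  have "(\<integral>\<^sup>+x. f x \<partial>S) = (\<integral>\<^sup>+x. f x \<partial>distr (M \<Otimes>\<^sub>M S) S (\<lambda>(y, x). case_nat y x))"
    by (simp add: PiM_iter)
  also have "\<dots> = (\<integral>\<^sup>+z. (case z of (y, x) \<Rightarrow> f (case_nat y x)) \<partial>(M \<Otimes>\<^sub>M S))"
    by (subst nn_integral_distr) (auto simp: split_beta')
  also have "\<dots> = (\<integral>\<^sup>+y. (\<integral>\<^sup>+x. f (case_nat y x) \<partial>S) \<partial>M)"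
    by (subst P.nn_integral_fst[symmetric]) auto
  finally show ?thesis .
qed

lemma integral_head:
  fixes f :: "(nat \<Rightarrow> real) \<Rightarrow> real"
  assumes [measurable]: "f \<in> borel_measurable S" and bounds: "\<And>x. 0 \<le> f x" "\<And>x. f x \<le> 1"
  shows "(\<integral>x. f x \<partial>S) = (\<integral>y. (\<integral>x. f (case_nat y x) \<partial>S) \<partial>M)"
proof -
  interpret MS: pair_prob_space M S ..
  have "(\<integral>x. f x \<partial>S) = (\<integral>x. f x \<partial>distr (M \<Otimes>\<^sub>M S) S (\<lambda>(y, x). case_nat y x))"
    by (simp add: PiM_iter)
  also have "\<dots> = (\<integral>z. (case z of (y, x) \<Rightarrow> f (case_nat y x)) \<partial>(M \<Otimes>\<^sub>M S))"
    by (subst integral_distr) (auto simp: split_beta')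
  also have "\<dots> = (\<integral>y. (\<integral>x. f (case_nat y x) \<partial>S) \<partial>M)"
    by (subst MS.integral_fst'[symmetric])
       (auto intro!: MS.P.integrable_const_bound[where B=1] simp: split_beta' bounds)
  finally show ?thesis .
qed

lemma harris_inequality_functions:
  fixes f g :: "(nat \<Rightarrow> real) \<Rightarrow> real"
  assumes "f \<in> borel_measurable S" "g \<in> borel_measurable S"
    and "\<And>x. 0 \<le> f x" "\<And>x. f x \<le> 1" "\<And>x. 0 \<le> g x" "\<And>x. g x \<le> 1"
    and "antitone_upto n f" "antitone_upto n g"
  shows "(\<integral>x. f x \<partial>S) * (\<integral>x. g x \<partial>S) \<le> (\<integral>x. f x * g x \<partial>S)"
  using assms
proof (induction n arbitrary: f g)
  case 0
  then have "f x = f (\<lambda>_. 0)" "g x = g (\<lambda>_. 0)" for x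
    by (auto simp: antitone_upto_def intro: antisym)
  then obtain a b where "f = (\<lambda>_. a)" "g = (\<lambda>_. b)" by blast
  then show ?case using P.prob_space by simp
next
  case (Suc n)
  note [measurable] = Suc.prems(1,2)
  note bounds = Suc.prems(3-6)
  define F where "F = (\<lambda>y. \<integral>x. f (case_nat y x) \<partial>S)"
  define G where "G = (\<lambda>y. \<integral>x. g (case_nat y x) \<partial>S)"
  have int: "integrable S (\<lambda>x. f (case_nat y x))" "integrable S (\<lambda>x. g (case_nat y x))" for y
    by (auto intro!: P.integrable_const_bound[where B=1] simp: bounds)
  have F01: "0 \<le> F y" "F y \<le> 1" and G01: "0 \<le> G y" "G y \<le> 1" for y
    using int by (auto simp: F_def G_def bounds intro!: P.integral_le_const)
  have [measurable]: "F \<in> borel_measurable M" "G \<in> borel_measurable M"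
    by (auto simp: F_def G_def)
  have "case_nat y x i \<le> case_nat z x i" if "y \<le> z" for y z :: real and x i
    using that by (auto split: nat.split)
  then have anti: "antimono F" "antimono G"
    using Suc.prems(7,8) int
    by (auto simp: F_def G_def intro!: antimonoI integral_mono elim!: antitone_uptoD)
  have fib: "F y * G y \<le> (\<integral>x. f (case_nat y x) * g (case_nat y x) \<partial>S)" for y
    unfolding F_def G_def
    using Suc.prems(7,8) by (intro Suc.IH antitone_upto_case_nat) (auto simp: bounds)
  have fg: "0 \<le> f x * g x" "f x * g x \<le> 1" for x
    using bounds by (auto simp: mult_le_one)
  have "(\<integral>x. f x \<partial>S) * (\<integral>x. g x \<partial>S) = M.expectation F * M.expectation G"
    unfolding F_def G_def by (subst (1 2) integral_head) (auto simp: bounds)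
  also have "\<dots> \<le> M.expectation (\<lambda>y. F y * G y)"
    using anti by (intro chebyshev_association M.prob_space_axioms) (auto simp: F01 G01)
  also have "\<dots> \<le> M.expectation (\<lambda>y. \<integral>x. f (case_nat y x) * g (case_nat y x) \<partial>S)"
  proof (intro integral_mono fib)
    show "integrable M (\<lambda>y. F y * G y)"
      by (auto intro!: M.integrable_const_bound[where B=1] simp: F01 G01 abs_mult mult_le_one)
    show "integrable M (\<lambda>y. \<integral>x. f (case_nat y x) * g (case_nat y x) \<partial>S)"
    proof (intro M.integrable_const_bound[where B=1] AE_I2)
      fix y
      have "0 \<le> (\<integral>x. f (case_nat y x) * g (case_nat y x) \<partial>S)"
        by (simp add: fg)
      moreover have "(\<integral>x. f (case_nat y x) * g (case_nat y x) \<partial>S) \<le> 1"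
        by (intro P.integral_le_const P.integrable_const_bound[where B=1]) 
          (use fg bounds in \<open>auto simp: abs_mult\<close>)
      ultimately show "norm (\<integral>x. f (case_nat y x) * g (case_nat y x) \<partial>S) \<le> 1" by simp
    qed auto
  qed
  also have "\<dots> = (\<integral>x. f x * g x \<partial>S)"
    by (subst (2) integral_head) (auto simp: fg)
  finally show ?case .
qed

lemma harris_inequality:
  assumes [measurable]: "Measurable.pred S \<phi>" "Measurable.pred S \<psi>"
    and "antitone_upto n \<phi>" "antitone_upto n \<psi>"
  shows "P.prob {x. \<phi> x} * P.prob {x. \<psi> x} \<le> P.prob {x. \<phi> x \<and> \<psi> x}"
proof -
  have "(\<integral>x. indicator {x. \<phi> x} x \<partial>S) * (\<integral>x. indicator {x. \<psi> x} x \<partial>S)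
      \<le> (\<integral>x. indicator {x. \<phi> x} x * (indicator {x. \<psi> x} x :: real) \<partial>S)"
    using assms(3,4)
    by (intro harris_inequality_functions[where n=n])
       (auto simp: antitone_upto_def indicator_def split: if_splits)
  also have "\<dots> = (\<integral>x. indicator {x. \<phi> x \<and> \<psi> x} x \<partial>S)"
    by (intro Bochner_Integration.integral_cong) (auto simp: indicator_def)
  finally show ?thesis by simp
qed

end

subsection \<open>The random walk\<close>

definition walk :: "nat \<Rightarrow> (nat \<Rightarrow> real) \<Rightarrow> real" where
  "walk n x = (\<Sum>i<n. x i)"

lemma walk_0 [simp]: "walk 0 x = 0"
  and walk_Suc: "walk (Suc n) x = walk n x + x n"
  by (simp_all add: walk_def)

lemma walk_add: "walk (k + n) x = walk k x + walk n (\<lambda>i. x (i + k))"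
  by (induction n) (simp_all add: walk_Suc add.commute)

lemma walk_cong: "(\<And>i. i < n \<Longrightarrow> x i = y i) \<Longrightarrow> walk n x = walk n y"
  by (simp add: walk_def)

lemma walk_mono: "(\<And>i. i < n \<Longrightarrow> x i \<le> y i) \<Longrightarrow> walk n x \<le> walk n y"
  unfolding walk_def by (rule sum_mono) simp

lemma walk_reverse:
  assumes "j \<le> k"
  shows "walk j (\<lambda>i. x (k - Suc i)) = walk k x - walk (k - j) x"
  using assms
proof (induction j)
  case (Suc j)
  then have "k - j = Suc (k - Suc j)" by simp
  then have "walk (k - j) x = walk (k - Suc j) x + x (k - Suc j)"
    by (metis walk_Suc)
  with Suc show ?case by (simp add: walk_Suc)
qed simp

definition below :: "nat \<Rightarrow> (nat \<Rightarrow> real) \<Rightarrow> bool" where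
  "below n x \<longleftrightarrow> (\<forall>j\<le>n. walk j x \<le> 0)"

definition ladder :: "nat \<Rightarrow> (nat \<Rightarrow> real) \<Rightarrow> bool" where
  "ladder n x \<longleftrightarrow> (\<forall>j\<le>n. walk n x \<le> walk j x)"

lemma below_Suc: "below (Suc n) x \<longleftrightarrow> below n x \<and> walk (Suc n) x \<le> 0"
  by (auto simp: below_def le_Suc_eq)

lemma below_reverse: "below k (\<lambda>i. x (k - Suc i)) \<longleftrightarrow> ladder k x"
proof -
  have "below k (\<lambda>i. x (k - Suc i)) \<longleftrightarrow> (\<forall>j\<le>k. walk k x \<le> walk (k - j) x)"
    by (auto simp: below_def walk_reverse)
  also have "\<dots> \<longleftrightarrow> ladder k x"
    by (auto simp: ladder_def) (metis diff_diff_cancel diff_le_self)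
  finally show ?thesis .
qed

lemma walk_cong_upto: "\<forall>i<n. x i = y i \<Longrightarrow> j \<le> n \<Longrightarrow> walk j x = walk j y"
  by (intro walk_cong) auto

lemma walk_mono_upto: "\<forall>i<n. x i \<le> y i \<Longrightarrow> j \<le> n \<Longrightarrow> walk j x \<le> walk j y"
  by (intro walk_mono) auto

lemma determined_below: "determined_upto n (below n)"
  unfolding determined_upto_def
proof (intro allI impI)
  fix x y :: "nat \<Rightarrow> real"
  assume "\<forall>i<n. x i = y i"
  then have "walk j x = walk j y" if "j \<le> n" for j
    using that by (rule walk_cong_upto)
  then show "below n x = below n y" by (simp add: below_def)
qed

lemma determined_ladder: "determined_upto n (ladder n)"
  unfolding determined_upto_def
proof (intro allI impI)
  fix x y :: "nat \<Rightarrow> real"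
  assume "\<forall>i<n. x i = y i"
  then have "walk j x = walk j y" if "j \<le> n" for j
    using that by (rule walk_cong_upto)
  then show "ladder n x = ladder n y" by (simp add: ladder_def)
qed

lemma antitone_walk_le: "k \<le> n \<Longrightarrow> antitone_upto n (\<lambda>x. walk k x \<le> c)"
  unfolding antitone_upto_def by (auto dest: walk_mono_upto)

lemma antitone_all:
  "(\<And>j. \<phi> j \<Longrightarrow> antitone_upto n (\<lambda>x. \<psi> j x)) \<Longrightarrow> antitone_upto n (\<lambda>x. \<forall>j. \<phi> j \<longrightarrow> \<psi> j x)"
  unfolding antitone_upto_def by auto

lemma antitone_below: "antitone_upto n (below n)"
  unfolding below_def by (intro antitone_all antitone_walk_le)

context real_sequence_space
begin

lemma measurable_walk [measurable]: "walk n \<in> borel_measurable S"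
  unfolding walk_def by measurable

lemma pred_below [measurable]: "Measurable.pred S (below n)"
  unfolding below_def by measurable

lemma pred_ladder [measurable]: "Measurable.pred S (ladder n)"
proof -
  have [measurable]: "Measurable.pred S (\<lambda>x. walk n x \<le> walk j x)" for j
    unfolding pred_def by (rule borel_measurable_le) (rule measurable_walk)+
  show ?thesis unfolding ladder_def by measurable
qed

definition survival :: "nat \<Rightarrow> real" where
  "survival n = P.prob {x. below n x}"

lemma survival_le_1: "survival n \<le> 1" and survival_nonneg: "0 \<le> survival n"
  by (simp_all add: survival_def)

lemma survival_antimono: "m \<le> n \<Longrightarrow> survival n \<le> survival m"
  unfolding survival_def
  by (intro P.finite_measure_mono Collect_in_sets) (auto simp: below_def)

lemma distr_coord: "distr S borel (\<lambda>x. x i) = M"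
proof -
  have "distr S borel (\<lambda>x. x i) = distr S M (\<lambda>x. x i)"
    by (rule distr_cong) auto
  then show ?thesis using PiM_component[of i] by simp
qed

lemma integrable_coord_fun:
  fixes g :: "real \<Rightarrow> real"
  assumes "g \<in> borel_measurable borel" "integrable M g"
  shows "integrable S (\<lambda>x. g (x i))"
proof -
  have "integrable (distr S borel (\<lambda>x. x i)) g" unfolding distr_coord by fact
  then show ?thesis by (rule integrable_distr[rotated]) (rule measurable_coord)
qed

lemma expectation_coord_fun:
  fixes g :: "real \<Rightarrow> real"
  assumes "g \<in> borel_measurable borel"
  shows "P.expectation (\<lambda>x. g (x i)) = (\<integral>y. g y \<partial>M)"
  using integral_distr[OF measurable_coord assms] unfolding distr_coord by simp

lemma prob_coord:
  assumes [measurable]: "Measurable.pred borel \<phi>"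
  shows "P.prob {x. \<phi> (x i)} = M.prob {y. \<phi> y}"
proof -
  have "M.prob {y. \<phi> y} = measure (distr S borel (\<lambda>x. x i)) {y. \<phi> y}"
    by (simp add: distr_coord)
  also have "\<dots> = P.prob {x. \<phi> (x i)}"
    by (subst measure_distr) (auto simp: vimage_def)
  finally show ?thesis ..
qed

lemma indep_coords: "P.indep_vars (\<lambda>_. borel) (\<lambda>i x. x i) UNIV"
proof (subst P.indep_vars_iff_distr_eq_PiM')
  have "distr S (Pi\<^sub>M UNIV (\<lambda>i. borel)) (\<lambda>x. restrict (\<lambda>i. x i) UNIV) = distr S S (\<lambda>x. x)"
    by (rule distr_cong) (auto intro!: sets_PiM_cong simp: restrict_UNIV)
  then show "distr S (Pi\<^sub>M UNIV (\<lambda>i. borel)) (\<lambda>x. restrict (\<lambda>i. x i) UNIV) =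
      (\<Pi>\<^sub>M i\<in>UNIV. distr S borel (\<lambda>x. x i))"
    by (simp add: distr_coord)
qed auto

end

locale centered_walk = real_sequence_space +
  assumes integrable_id: "integrable M (\<lambda>y. y)"
    and mean_zero: "(\<integral>y. y \<partial>M) = 0"
    and integrable_square: "integrable M (\<lambda>y. y\<^sup>2)"
    and nondegenerate: "\<not> (AE y in M. y = 0)"
begin

definition \<sigma> :: real where "\<sigma> = sqrt (\<integral>y. y\<^sup>2 \<partial>M)"

lemma sigma_pos: "\<sigma> > 0"
proof -
  have "(\<integral>y. y\<^sup>2 \<partial>M) \<noteq> 0"
    using integral_nonneg_eq_0_iff_AE[OF integrable_square] nondegenerate by simp
  moreover have "0 \<le> (\<integral>y. y\<^sup>2 \<partial>M)" by simp
  ultimately have "0 < (\<integral>y. y\<^sup>2 \<partial>M)" by linarith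
  then show ?thesis by (simp add: \<sigma>_def)
qed

lemma integrable_coord: "integrable S (\<lambda>x. x i)"
  using integrable_id by (rule integrable_coord_fun[rotated]) simp

lemma integrable_coord_square: "integrable S (\<lambda>x. (x i)\<^sup>2)"
  using integrable_square by (rule integrable_coord_fun[rotated]) simp

lemma integrable_walk: "integrable S (walk n)"
  unfolding walk_def by (intro Bochner_Integration.integrable_sum integrable_coord)

lemma expectation_coord: "P.expectation (\<lambda>x. x i) = 0"
  using expectation_coord_fun[of "\<lambda>y. y" i] by (simp add: mean_zero)

lemma walk_very_negative: "\<exists>c>0. \<forall>\<^sub>F n in sequentially. c \<le> P.prob {x. walk n x \<le> - (\<sigma> * sqrt n)}"
proof -
  let ?N = std_normal_distribution
  interpret N: real_distribution ?N by (rule real_dist_normal_dist)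
  have var: "P.variance (\<lambda>x. x i) = \<sigma>\<^sup>2" for i
  proof -
    have "P.variance (\<lambda>x. x i) = P.expectation (\<lambda>x. (x i)\<^sup>2)"
      unfolding expectation_coord by simp
    also have "\<dots> = (\<integral>y. y\<^sup>2 \<partial>M)"
      by (rule expectation_coord_fun) simp
    also have "\<dots> = \<sigma>\<^sup>2" unfolding \<sigma>_def by simp
    finally show ?thesis .
  qed
  have "weak_conv_m (\<lambda>n. distr S borel (\<lambda>x. (\<Sum>i<n. x i) / sqrt (n * \<sigma>\<^sup>2))) ?N"
    by (rule P.central_limit_theorem_zero_mean[OF indep_coords expectation_coord sigma_pos
          integrable_coord_square var distr_coord])
  moreover have "isCont (cdf ?N) (-1)"
  proof (subst N.isCont_cdf)
    have "emeasure ?N {-1} = (\<integral>\<^sup>+x. ennreal (std_normal_density x) * indicator {-1} x \<partial>lborel)"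
      by (subst emeasure_density) auto
    also have "\<dots> = 0"
      by (subst nn_integral_0_iff_AE) (use AE_lborel_singleton[of "-1::real"] in \<open>auto elim!: eventually_mono\<close>)
    finally show "measure ?N {-1} = 0" by (simp add: measure_def)
  qed
  ultimately have "(\<lambda>n. cdf (distr S borel (\<lambda>x. (\<Sum>i<n. x i) / sqrt (n * \<sigma>\<^sup>2))) (-1)) \<longlonglongrightarrow> cdf ?N (-1)"
    unfolding weak_conv_m_def weak_conv_def by blast
  moreover have pos: "cdf ?N (-1) > 0"
  proof (rule ccontr)
    assume "\<not> ?thesis"
    then have "measure ?N {..-1} = 0" by (simp add: cdf_def not_less measure_le_0_iff)
    then have "emeasure ?N {..-1} = 0" by (simp add: N.emeasure_eq_measure)
    then have "AE x in lborel. ennreal (std_normal_density x) * indicator {..-1} x = 0"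
      by (subst (asm) emeasure_density) (auto simp: nn_integral_0_iff_AE)
    then have "AE x in lborel. x \<notin> {..-1::real}"
      by (rule eventually_mono) (use normal_density_pos[of 1 0] in \<open>auto simp: indicator_def less_le split: if_splits\<close>)
    then have "emeasure lborel {..-1::real} = 0"
      by (subst (asm) AE_iff_measurable[where N="{..-1}"]) auto
    moreover have "emeasure lborel {-2..-1::real} \<le> emeasure lborel {..-1::real}"
      by (intro emeasure_mono) auto
    ultimately show False by simp
  qed
  ultimately have "\<forall>\<^sub>F n in sequentially. cdf ?N (-1) / 2 <
      cdf (distr S borel (\<lambda>x. (\<Sum>i<n. x i) / sqrt (n * \<sigma>\<^sup>2))) (-1)"
    by (intro order_tendstoD) auto
  then have "\<forall>\<^sub>F n in sequentially. cdf ?N (-1) / 2 \<le> P.prob {x. walk n x \<le> - (\<sigma> * sqrt n)}"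
    using eventually_gt_at_top[of 0]
  proof eventually_elim
    case (elim n)
    have "cdf (distr S borel (\<lambda>x. (\<Sum>i<n. x i) / sqrt (n * \<sigma>\<^sup>2))) (-1)
        = P.prob {x. (\<Sum>i<n. x i) / sqrt (n * \<sigma>\<^sup>2) \<le> -1}"
      unfolding cdf_def by (subst measure_distr) (auto simp: vimage_def)
    also have "{x. (\<Sum>i<n. x i) / sqrt (n * \<sigma>\<^sup>2) \<le> -1} = {x. walk n x \<le> - (\<sigma> * sqrt n)}"
      using elim sigma_pos by (auto simp: walk_def real_sqrt_mult pos_divide_le_eq mult.commute)
    finally show ?case using elim by simp
  qed
  with pos show ?thesis by (intro exI[of _ "cdf ?N (-1) / 2"]) auto
qed

lemma negative_step: "\<exists>\<delta>>0. M.prob {y. y < - \<delta>} > 0"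
proof (rule ccontr)
  assume neg: "\<not> ?thesis"
  have "AE y in M. y \<ge> - (1 / real (Suc n))" for n
  proof -
    have "M.prob {y. y < - (1 / real (Suc n))} = 0"
      using neg measure_nonneg[of M "{y. y < - (1 / real (Suc n))}"]
      by (metis antisym not_less of_nat_0_less_iff zero_less_Suc zero_less_divide_1_iff)
    then have "AE y in M. y \<notin> {y. y < - (1 / real (Suc n))}"
      by (subst AE_iff_measurable[where N="{y. y < - (1 / real (Suc n))}"])
         (auto simp: M.emeasure_eq_measure)
    then show ?thesis by eventually_elim auto
  qed
  then have "AE y in M. \<forall>n. y \<ge> - (1 / real (Suc n))" by (simp add: AE_all_countable)
  then have nonneg: "AE y in M. 0 \<le> y"
  proof eventually_elim
    case (elim y)
    show ?case
    proof (rule ccontr)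
      assume "\<not> 0 \<le> y"
      then obtain n where "1 / real (Suc n) < - y" using reals_Archimedean[of "- y"]
        by (auto simp: inverse_eq_divide)
      with elim show False by (smt (verit))
    qed
  qed
  then have "AE y in M. y = 0"
    using integral_nonneg_eq_0_iff_AE[OF integrable_id nonneg] mean_zero by simp
  with nondegenerate show False by simp
qed

end

subsection \<open>Upper bound for the survival probability of the walk\<close>

context real_sequence_space
begin

lemma integral_prefix_coord:
  assumes [measurable]: "Measurable.pred S \<phi>" and det: "determined_upto k \<phi>"
    and int: "integrable M (\<lambda>y. y)"
  shows "P.expectation (\<lambda>x. indicator {x. \<phi> x} x * x k) = P.prob {x. \<phi> x} * (\<integral>y. y \<partial>M)"
proof -
  interpret SS: pair_prob_space S S ..
  have [measurable]: "{x. \<phi> x} \<in> sets S" by (rule Collect_in_sets) fact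
  let ?f = "\<lambda>x::nat \<Rightarrow> real. indicator {x. \<phi> x} x * x k"
  let ?c = "\<lambda>(x, y). comb_seq k x y :: nat \<Rightarrow> real"
  have c [measurable]: "?c \<in> S \<Otimes>\<^sub>M S \<rightarrow>\<^sub>M S" by (rule measurable_comb_seq)
  have intk: "integrable S (\<lambda>x. x k)"
    using int by (rule integrable_coord_fun[rotated]) simp
  have f [measurable]: "?f \<in> borel_measurable S" by measurable
  have "integrable S ?f"
    by (rule Bochner_Integration.integrable_bound[OF intk]) (auto simp: indicator_def)
  then have "integrable (distr (S \<Otimes>\<^sub>M S) S ?c) ?f" by (simp only: PiM_comb_seq)
  then have "integrable (S \<Otimes>\<^sub>M S) (\<lambda>z. ?f (?c z))" by (rule integrable_distr[OF c])
  moreover have pre: "\<phi> (comb_seq k x y) = \<phi> x" for x y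
    using det by (auto simp: determined_upto_def comb_seq_def)
  have eq: "?f (?c z) = (case z of (x, y) \<Rightarrow> indicator {x. \<phi> x} x * y 0)" for z
    by (cases z) (auto simp: indicator_def pre comb_seq_def)
  ultimately have int2: "integrable (S \<Otimes>\<^sub>M S) (\<lambda>(x, y). indicator {x. \<phi> x} x * y 0 :: real)"
    by (simp only: eq)
  have "P.expectation ?f = (\<integral>x. ?f x \<partial>distr (S \<Otimes>\<^sub>M S) S ?c)" by (simp only: PiM_comb_seq)
  also have "\<dots> = (\<integral>z. ?f (?c z) \<partial>(S \<Otimes>\<^sub>M S))" by (rule integral_distr[OF c f])
  also have "\<dots> = (\<integral>z. (case z of (x, y) \<Rightarrow> indicator {x. \<phi> x} x * y 0) \<partial>(S \<Otimes>\<^sub>M S))"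
    by (simp only: eq)
  also have "\<dots> = (\<integral>x. \<integral>y. indicator {x. \<phi> x} x * y 0 \<partial>S \<partial>S)"
    using SS.integral_fst'[OF int2] by simp
  also have "\<dots> = (\<integral>x. indicator {x. \<phi> x} x * (\<integral>y. y \<partial>M) \<partial>S)"
    using expectation_coord_fun[of "\<lambda>y. y" 0] by simp
  also have "\<dots> = P.prob {x. \<phi> x} * (\<integral>y. y \<partial>M)" by simp
  finally show ?thesis .
qed

lemma nn_integral_reversed_excursion:
  "(\<integral>\<^sup>+x. ennreal (max 0 (walk (Suc k) x)) * indicator {x. below k x} x \<partial>S)
    = (\<integral>\<^sup>+y. \<integral>\<^sup>+x. ennreal (max 0 (y + walk k x)) * indicator {x. ladder k x} x \<partial>S \<partial>M)"
proof -
  define \<pi> where "\<pi> = (\<lambda>i. if i \<le> k then k - i else i)"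
  have "inj \<pi>" by (auto simp: \<pi>_def inj_on_def split: if_splits)
  have [measurable]: "{x. below k x} \<in> sets S" by (rule Collect_in_sets) measurable
  let ?F = "\<lambda>x. ennreal (max 0 (walk (Suc k) x)) * indicator {x. below k x} x"
  have [measurable]: "?F \<in> borel_measurable S" by measurable
  have "(\<integral>\<^sup>+x. ?F x \<partial>S) = (\<integral>\<^sup>+x. ?F (\<lambda>i. x (\<pi> i)) \<partial>S)"
    using \<open>inj \<pi>\<close> by (intro nn_integral_reindex[symmetric]) auto
  also have "\<dots> = (\<integral>\<^sup>+y. \<integral>\<^sup>+x. ?F (\<lambda>i. case_nat y x (\<pi> i)) \<partial>S \<partial>M)"
    by (rule nn_integral_head) (rule measurable_compose[OF measurable_reindex], measurable)
  moreover have "?F (\<lambda>i. case_nat y x (\<pi> i)) =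
      ennreal (max 0 (y + walk k x)) * indicator {x. ladder k x} x" for x y
  proof -
    have \<pi>': "case_nat y x (\<pi> i) = x (k - Suc i)" if "i < k" for i
      using that by (auto simp: \<pi>_def split: nat.split) (metis Suc_diff_Suc diff_Suc_Suc nat.inject)
    have w: "walk j (\<lambda>i. case_nat y x (\<pi> i)) = walk j (\<lambda>i. x (k - Suc i))" if "j \<le> k" for j
      using that by (intro walk_cong \<pi>') auto
    then have "below k (\<lambda>i. case_nat y x (\<pi> i)) \<longleftrightarrow> ladder k x"
      using below_reverse[of k x] by (simp add: below_def)
    moreover have "walk (Suc k) (\<lambda>i. case_nat y x (\<pi> i)) = y + walk k x"
      by (simp add: walk_Suc w walk_reverse) (simp add: \<pi>_def)
    ultimately show ?thesis by (simp add: indicator_def)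
  qed
  ultimately show ?thesis by (simp only:)
qed

text \<open>At two ladder times with heights in the same interval of length \<open>\<delta>\<close> the walk cannot step
  down by more than \<open>\<delta>\<close> right after the first one; this bounds the renewal measure of the ladder
  heights.\<close>

lemma ladder_interval_bound:
  assumes "\<delta> > 0"
  shows "(\<Sum>k<n. P.prob {x. ladder k x \<and> a \<le> - walk k x \<and> - walk k x < a + \<delta>}) * M.prob {y. y < - \<delta>} \<le> 1"
proof -
  let ?L = "\<lambda>k x. ladder k x \<and> a \<le> - walk k x \<and> - walk k x < a + \<delta>"
  define E where "E = (\<lambda>k. {x. ?L k x \<and> x (0 + k) < - \<delta>})"
  have [measurable]: "Measurable.pred S (?L k)" for k by measurable
  have E: "P.prob (E k) = P.prob {x. ?L k x} * M.prob {y. y < - \<delta>}" for k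
  proof -
    have "determined_upto k (?L k)"
      using determined_ladder[of k] unfolding determined_upto_def by (metis walk_cong)
    then have "P.prob (E k) = P.prob {x. ?L k x} * P.prob {x. x 0 < - \<delta>}"
      unfolding E_def by (intro prob_prefix_suffix) measurable
    also have "P.prob {x. x 0 < - \<delta>} = M.prob {y. y < - \<delta>}"
      by (intro prob_coord) measurable
    finally show ?thesis .
  qed
  have disjoint: False if "x \<in> E k" "x \<in> E j" "k < j" for x k j
  proof -
    have "walk j x \<le> walk (Suc k) x" using that by (auto simp: E_def ladder_def)
    also have "\<dots> < - a - \<delta>" using that by (auto simp: E_def walk_Suc)
    finally show False using that by (auto simp: E_def)
  qed
  have "(\<Sum>k<n. P.prob {x. ?L k x}) * M.prob {y. y < - \<delta>} = (\<Sum>k<n. P.prob (E k))"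
    by (simp add: E sum_distrib_right)
  also have "\<dots> = P.prob (\<Union>k\<in>{..<n}. E k)"
  proof (rule P.finite_measure_finite_Union[symmetric])
    show "E ` {..<n} \<subseteq> P.events"
      unfolding E_def by (auto intro!: Collect_in_sets)
    show "disjoint_family_on E {..<n}"
      using disjoint by (auto simp: disjoint_family_on_def) (metis linorder_neqE_nat)
  qed simp
  also have "\<dots> \<le> 1" by simp
  finally show ?thesis .
qed

lemma ladder_linear_bound:
  assumes \<delta>: "\<delta> > 0" and \<rho>: "M.prob {y. y < - \<delta>} > 0" and "y \<ge> 0"
  shows "(\<Sum>k<n. P.prob {x. ladder k x \<and> - y \<le> walk k x}) \<le> (y / \<delta> + 1) / M.prob {y. y < - \<delta>}"
proof -
  let ?\<rho> = "M.prob {y. y < - \<delta>}"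
  let ?L = "\<lambda>i k x. ladder k x \<and> real i * \<delta> \<le> - walk k x \<and> - walk k x < real i * \<delta> + \<delta>"
  define m where "m = Suc (nat \<lfloor>y / \<delta>\<rfloor>)"
  have [measurable]: "Measurable.pred S (?L i k)" for i k by measurable
  have "P.prob {x. ladder k x \<and> - y \<le> walk k x} \<le> (\<Sum>i<m. P.prob {x. ?L i k x})" for k
  proof -
    have "{x. ladder k x \<and> - y \<le> walk k x} \<subseteq> (\<Union>i\<in>{..<m}. {x. ?L i k x})"
    proof safe
      fix x assume x: "ladder k x" "- y \<le> walk k x"
      define i where "i = nat \<lfloor>- walk k x / \<delta>\<rfloor>"
      have "walk k x \<le> 0" using x(1) by (auto simp: ladder_def dest: spec[of _ 0])
      then have nn: "0 \<le> - walk k x / \<delta>" using \<delta> by (simp add: divide_nonpos_pos)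
      have "i \<le> nat \<lfloor>y / \<delta>\<rfloor>"
        unfolding i_def using x(2) \<delta> by (intro nat_mono floor_mono divide_right_mono) auto
      then have "i < m" by (simp add: m_def)
      moreover have "real i \<le> - walk k x / \<delta>" "- walk k x / \<delta> < real i + 1"
        using nn unfolding i_def by linarith+
      then have "real i * \<delta> \<le> - walk k x" "- walk k x < real i * \<delta> + \<delta>"
        using \<delta> by (auto simp: field_simps)
      ultimately show "x \<in> (\<Union>i\<in>{..<m}. {x. ?L i k x})" using x by blast
    qed
    then have "P.prob {x. ladder k x \<and> - y \<le> walk k x} \<le> P.prob (\<Union>i\<in>{..<m}. {x. ?L i k x})"
      by (intro P.finite_measure_mono) (auto intro!: sets.finite_UN Collect_in_sets)
    also have "\<dots> \<le> (\<Sum>i<m. P.prob {x. ?L i k x})"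
      by (intro P.finite_measure_subadditive_finite) (auto intro!: Collect_in_sets)
    finally show ?thesis .
  qed
  then have "(\<Sum>k<n. P.prob {x. ladder k x \<and> - y \<le> walk k x}) \<le> (\<Sum>k<n. \<Sum>i<m. P.prob {x. ?L i k x})"
    by (rule sum_mono)
  also have "\<dots> = (\<Sum>i<m. \<Sum>k<n. P.prob {x. ?L i k x})" by (rule sum.swap)
  also have "\<dots> \<le> (\<Sum>i<m. 1 / ?\<rho>)"
    using ladder_interval_bound[OF \<delta>] \<rho> by (intro sum_mono) (simp add: pos_le_divide_eq)
  also have "\<dots> = real m / ?\<rho>" by simp
  also have "\<dots> \<le> (y / \<delta> + 1) / ?\<rho>"
  proof (rule divide_right_mono)
    have "0 \<le> y / \<delta>" using \<delta> \<open>y \<ge> 0\<close> by simp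
    then show "real m \<le> y / \<delta> + 1" unfolding m_def by linarith
  qed simp
  finally show ?thesis .
qed

end

context centered_walk
begin

lemma expectation_below_step:
  "P.expectation (\<lambda>x. - walk (Suc k) x * indicator {x. below (Suc k) x} x)
    = P.expectation (\<lambda>x. - walk k x * indicator {x. below k x} x)
      + P.expectation (\<lambda>x. max 0 (walk (Suc k) x) * indicator {x. below k x} x)"
proof -
  have [measurable]: "{x. below k x} \<in> sets S" for k by (rule Collect_in_sets) measurable
  have i1: "integrable S (\<lambda>x. - walk k x * indicator {x. below k x} x)"
    by (rule Bochner_Integration.integrable_bound[OF integrable_walk[of k]]) (auto simp: indicator_def)
  have i2: "integrable S (\<lambda>x. max 0 (walk (Suc k) x) * indicator {x. below k x} x)"
    by (rule Bochner_Integration.integrable_bound[OF integrable_walk[of "Suc k"]]) (auto simp: indicator_def)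
  have i3: "integrable S (\<lambda>x. indicator {x. below k x} x * x k)"
    by (rule Bochner_Integration.integrable_bound[OF integrable_coord[of k]]) (auto simp: indicator_def)
  have "- walk (Suc k) x * indicator {x. below (Suc k) x} x =
      - walk k x * indicator {x. below k x} x + max 0 (walk (Suc k) x) * indicator {x. below k x} x
      - indicator {x. below k x} x * x k" for x
    by (auto simp: indicator_def below_Suc walk_Suc max_def)
  then have "P.expectation (\<lambda>x. - walk (Suc k) x * indicator {x. below (Suc k) x} x) =
     P.expectation (\<lambda>x. - walk k x * indicator {x. below k x} x + max 0 (walk (Suc k) x) * indicator {x. below k x} x
      - indicator {x. below k x} x * x k)" by (simp only:)
  also have "\<dots> = P.expectation (\<lambda>x. - walk k x * indicator {x. below k x} x)
      + P.expectation (\<lambda>x. max 0 (walk (Suc k) x) * indicator {x. below k x} x)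
      - P.expectation (\<lambda>x. indicator {x. below k x} x * x k)"
    using i1 i2 i3 by simp
  also have "P.expectation (\<lambda>x. indicator {x. below k x} x * x k) = 0"
    using integral_prefix_coord[OF pred_below determined_below integrable_id] by (simp add: mean_zero)
  finally show ?thesis by simp
qed

lemma expectation_below_sum:
  "P.expectation (\<lambda>x. - walk n x * indicator {x. below n x} x)
    = (\<Sum>k<n. P.expectation (\<lambda>x. max 0 (walk (Suc k) x) * indicator {x. below k x} x))"
  by (induction n) (simp_all only: expectation_below_step sum.lessThan_Suc, simp_all)

lemma expectation_below_bounded:
  "\<exists>K. \<forall>n. P.expectation (\<lambda>x. - walk n x * indicator {x. below n x} x) \<le> K"
proof -
  obtain \<delta> where \<delta>: "\<delta> > 0" "M.prob {y. y < - \<delta>} > 0" using negative_step by blast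
  define \<rho> where "\<rho> = M.prob {y. y < - \<delta>}"
  have [measurable]: "{x. below k x} \<in> sets S" "{x. ladder k x} \<in> sets S" 
    "{x. ladder k x \<and> - y \<le> walk k x} \<in> sets S" for k y
    by (rule Collect_in_sets; measurable)+
  define h where "h = (\<lambda>y::real. max 0 y * ((max 0 y / \<delta> + 1) / \<rho>))"
  have h_nonneg: "0 \<le> h y" for y using \<delta> by (simp add: h_def \<rho>_def)
  have "integrable M (\<lambda>y. y\<^sup>2 * (1 / (\<delta> * \<rho>)) + \<bar>y\<bar> * (1 / \<rho>))"
    using integrable_square integrable_id by auto
  moreover have "h \<in> borel_measurable M" 
    unfolding measurable_cong_sets[OF sets_M refl] h_def by measurable
  ultimately have int_h: "integrable M h"
    by (rule Bochner_Integration.integrable_bound)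
       (use \<delta> in \<open>auto simp: h_def \<rho>_def max_def field_simps power2_eq_square\<close>)
  have "P.expectation (\<lambda>x. - walk n x * indicator {x. below n x} x) \<le> M.expectation h" for n
  proof -
    have "ennreal (P.expectation (\<lambda>x. - walk n x * indicator {x. below n x} x))
        = (\<Sum>k<n. ennreal (P.expectation (\<lambda>x. max 0 (walk (Suc k) x) * indicator {x. below k x} x)))"
      unfolding expectation_below_sum by (rule sum_ennreal[symmetric]) simp
    also have "\<dots> = (\<Sum>k<n. \<integral>\<^sup>+x. ennreal (max 0 (walk (Suc k) x)) * indicator {x. below k x} x \<partial>S)"
    proof (rule sum.cong[OF refl])
      fix k
      have "integrable S (\<lambda>x. max 0 (walk (Suc k) x) * indicator {x. below k x} x)"
        by (rule Bochner_Integration.integrable_bound[OF integrable_walk[of "Suc k"]]) (auto simp: indicator_def)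
      then have "ennreal (P.expectation (\<lambda>x. max 0 (walk (Suc k) x) * indicator {x. below k x} x))
          = (\<integral>\<^sup>+x. ennreal (max 0 (walk (Suc k) x) * indicator {x. below k x} x) \<partial>S)"
        by (intro nn_integral_eq_integral[symmetric]) auto
      then show "ennreal (P.expectation (\<lambda>x. max 0 (walk (Suc k) x) * indicator {x. below k x} x))
          = (\<integral>\<^sup>+x. ennreal (max 0 (walk (Suc k) x)) * indicator {x. below k x} x \<partial>S)"
        by (simp add: ennreal_mult' ennreal_indicator)
    qed
    also have "\<dots> = (\<Sum>k<n. \<integral>\<^sup>+y. \<integral>\<^sup>+x. ennreal (max 0 (y + walk k x)) * indicator {x. ladder k x} x \<partial>S \<partial>M)"
      by (simp only: nn_integral_reversed_excursion)
    also have "\<dots> = (\<integral>\<^sup>+y. (\<Sum>k<n. \<integral>\<^sup>+x. ennreal (max 0 (y + walk k x)) * indicator {x. ladder k x} x \<partial>S) \<partial>M)"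
      by (rule nn_integral_sum[symmetric]) measurable
    also have "\<dots> \<le> (\<integral>\<^sup>+y. ennreal (h y) \<partial>M)"
    proof (rule nn_integral_mono)
      fix y
      have "(\<integral>\<^sup>+x. ennreal (max 0 (y + walk k x)) * indicator {x. ladder k x} x \<partial>S)
          \<le> ennreal (max 0 y * P.prob {x. ladder k x \<and> - max 0 y \<le> walk k x})" for k
      proof -
        have "(\<integral>\<^sup>+x. ennreal (max 0 (y + walk k x)) * indicator {x. ladder k x} x \<partial>S)
          \<le> (\<integral>\<^sup>+x. ennreal (max 0 y) * indicator {x. ladder k x \<and> - max 0 y \<le> walk k x} x \<partial>S)"
        proof (rule nn_integral_mono)
          fix x
          have "walk k x \<le> 0" if "ladder k x"
            using that by (auto simp: ladder_def dest: spec[of _ 0])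
          then show "ennreal (max 0 (y + walk k x)) * indicator {x. ladder k x} x
              \<le> ennreal (max 0 y) * indicator {x. ladder k x \<and> - max 0 y \<le> walk k x} x"
            by (cases "- max 0 y \<le> walk k x")
               (auto simp: indicator_def ennreal_eq_0_iff intro!: ennreal_leI)
        qed
        also have "\<dots> = ennreal (max 0 y * P.prob {x. ladder k x \<and> - max 0 y \<le> walk k x})"
          by (subst nn_integral_cmult_indicator) (auto simp: P.emeasure_eq_measure ennreal_mult')
        finally show ?thesis .
      qed
      then have "(\<Sum>k<n. \<integral>\<^sup>+x. ennreal (max 0 (y + walk k x)) * indicator {x. ladder k x} x \<partial>S)
          \<le> (\<Sum>k<n. ennreal (max 0 y * P.prob {x. ladder k x \<and> - max 0 y \<le> walk k x}))"
        by (rule sum_mono)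
      also have "\<dots> = ennreal (max 0 y * (\<Sum>k<n. P.prob {x. ladder k x \<and> - max 0 y \<le> walk k x}))"
        by (subst sum_ennreal) (auto simp: sum_distrib_left)
      also have "\<dots> \<le> ennreal (h y)"
        unfolding h_def \<rho>_def using ladder_linear_bound[OF \<delta>, of "max 0 y" n]
        by (intro ennreal_leI mult_left_mono) auto
      finally show "(\<Sum>k<n. \<integral>\<^sup>+x. ennreal (max 0 (y + walk k x)) * indicator {x. ladder k x} x \<partial>S)
          \<le> ennreal (h y)" .
    qed
    also have "\<dots> = ennreal (M.expectation h)"
      using int_h h_nonneg by (intro nn_integral_eq_integral) auto
    finally show ?thesis
      using h_nonneg by (subst (asm) ennreal_le_iff) (auto intro!: integral_nonneg_AE)
  qed
  then show ?thesis by blast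
qed

text \<open>Given survival, a negative level of order \<open>\<surd>n\<close> is at least as likely as without
  conditioning (Harris), so the bounded expectation of \<open>- walk n\<close> on survival forces the
  survival probability to be \<open>O(1 / \<surd>n)\<close>.\<close>

theorem survival_upper_bound: "\<exists>C>0. \<forall>n. survival n \<le> C / sqrt (Suc n)"
proof -
  obtain K where K: "P.expectation (\<lambda>x. - walk n x * indicator {x. below n x} x) \<le> K" for n
    using expectation_below_bounded by blast
  obtain c where c: "c > 0" "\<forall>\<^sub>F n in sequentially. c \<le> P.prob {x. walk n x \<le> - (\<sigma> * sqrt n)}"
    using walk_very_negative by blast
  then obtain m where m: "c \<le> P.prob {x. walk n x \<le> - (\<sigma> * sqrt n)}" if "n \<ge> m" for n
    by (auto simp: eventually_at_top_linorder)
  have main: "survival n * c * (\<sigma> * sqrt n) \<le> K" if "n \<ge> m" for n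
  proof -
    have [measurable]: "{x. below n x} \<in> sets S" "{x. below n x \<and> walk n x \<le> - (\<sigma> * sqrt n)} \<in> sets S"
      by (rule Collect_in_sets; measurable)+
    have "survival n * c \<le> survival n * P.prob {x. walk n x \<le> - (\<sigma> * sqrt n)}"
      by (intro mult_left_mono m that survival_nonneg)
    also have "\<dots> \<le> P.prob {x. below n x \<and> walk n x \<le> - (\<sigma> * sqrt n)}"
      unfolding survival_def
      by (intro harris_inequality[where n=n] antitone_below antitone_walk_le) auto
    finally have "survival n * c * (\<sigma> * sqrt n)
        \<le> P.prob {x. below n x \<and> walk n x \<le> - (\<sigma> * sqrt n)} * (\<sigma> * sqrt n)"
      using sigma_pos by (intro mult_right_mono) auto
    also have "\<dots> = P.expectation (\<lambda>x. indicator {x. below n x \<and> walk n x \<le> - (\<sigma> * sqrt n)} x * (\<sigma> * sqrt n))"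
      by simp
    also have "\<dots> \<le> P.expectation (\<lambda>x. - walk n x * indicator {x. below n x} x)"
    proof (rule integral_mono)
      show "integrable S (\<lambda>x. - walk n x * indicator {x. below n x} x)"
        by (rule Bochner_Integration.integrable_bound[OF integrable_walk[of n]]) (auto simp: indicator_def)
      show "indicator {x. below n x \<and> walk n x \<le> - (\<sigma> * sqrt n)} x * (\<sigma> * sqrt n)
          \<le> - walk n x * indicator {x. below n x} x" for x
        by (auto simp: indicator_def below_def)
    qed (auto simp: P.emeasure_eq_measure)
    also have "\<dots> \<le> K" by (rule K)
    finally show ?thesis .
  qed
  define C where "C = max (sqrt (Suc m)) (2 * (K / (c * \<sigma>)))"
  have "C > 0" by (simp add: C_def less_max_iff_disj)
  moreover have "survival n \<le> C / sqrt (Suc n)" for n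
  proof (cases "n \<ge> m \<and> n > 0")
    case True
    have "sqrt (Suc n) \<le> 2 * sqrt n"
      using True by (intro real_le_lsqrt) (auto simp: power_mult_distrib)
    then have "survival n * sqrt (Suc n) \<le> survival n * (2 * sqrt n)"
      by (intro mult_left_mono survival_nonneg)
    also have "\<dots> \<le> 2 * (K / (c * \<sigma>))"
      using main[of n] True c sigma_pos by (simp add: field_simps)
    also have "\<dots> \<le> C" by (simp add: C_def)
    finally show ?thesis by (simp add: field_simps)
  next
    case False
    then have "sqrt (Suc n) \<le> sqrt (Suc m)" by auto
    also have "\<dots> \<le> C" by (simp add: C_def)
    finally have "1 \<le> C / sqrt (Suc n)" by (simp add: field_simps)
    then show ?thesis using survival_le_1[of n] by linarith
  qed
  ultimately show ?thesis by blast
qed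

end

subsection \<open>Lower bound for the survival probability of the walk\<close>

lemma sum_inverse_sqrt_le: "(\<Sum>j<m. 1 / sqrt (Suc j)) \<le> 2 * sqrt m"
proof (induction m)
  case (Suc m)
  have "sqrt (Suc m) * sqrt (Suc m) = Suc m" "sqrt m * sqrt m = m" by simp_all
  moreover have "0 \<le> (sqrt (Suc m) - sqrt m) * (sqrt (Suc m) - sqrt m)" by simp
  ultimately have "2 * sqrt m * sqrt (Suc m) + 1 \<le> 2 * (sqrt (Suc m) * sqrt (Suc m))"
    by (simp add: algebra_simps)
  then have "2 * sqrt m + 1 / sqrt (Suc m) \<le> 2 * sqrt (Suc m)"
    by (simp add: field_simps)
  with Suc show ?case by simp
qed simp

lemma walk_uminus: "walk n (\<lambda>i. - x i) = - walk n x"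
  by (simp add: walk_def sum_negf)

lemma ladder_uminus: "ladder n (\<lambda>i. - x i) \<longleftrightarrow> (\<forall>j\<le>n. walk j x \<le> walk n x)"
  by (simp add: ladder_def walk_uminus)

lemma walk_attains_max:
  obtains k where "k \<le> n" "\<And>j. j \<le> n \<Longrightarrow> walk j x \<le> walk k x"
proof -
  define w where "w = Max ((\<lambda>j. walk j x) ` {..n})"
  have "w \<in> (\<lambda>j. walk j x) ` {..n}" unfolding w_def by (intro Max_in) auto
  then obtain k where "k \<le> n" "w = walk k x" by auto
  moreover have "walk j x \<le> w" if "j \<le> n" for j
    unfolding w_def using that by (intro Max_ge) auto
  ultimately show ?thesis using that by blast
qed

context real_sequence_space
begin

lemma prob_ladder: "P.prob {x. ladder k x} = survival k"
proof -
  define \<pi> where "\<pi> = (\<lambda>i. if i < k then k - Suc i else i)"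
  have "inj \<pi>" by (auto simp: \<pi>_def inj_on_def split: if_splits)
  have "below k (\<lambda>i. x (\<pi> i)) \<longleftrightarrow> ladder k x" for x
  proof -
    have "below k (\<lambda>i. x (\<pi> i)) \<longleftrightarrow> below k (\<lambda>i. x (k - Suc i))"
      using determined_below[of k] unfolding determined_upto_def \<pi>_def by auto
    then show ?thesis by (simp add: below_reverse)
  qed
  then show ?thesis
    using prob_reindex[OF \<open>inj \<pi>\<close> pred_below[of k]] by (simp add: survival_def)
qed

lemma real_sequence_space_uminus: "real_sequence_space (distr M borel uminus)"
  by (intro real_sequence_spaceI M.prob_space_distr)
     (simp_all add: measurable_cong_sets[OF sets_M refl])

lemma distr_uminus:
  "distr S (Pi\<^sub>M UNIV (\<lambda>_. borel)) (\<lambda>x i. - x i) = Pi\<^sub>M UNIV (\<lambda>_. distr M borel uminus)"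
proof -
  have "P.indep_vars (\<lambda>_. borel) (\<lambda>i x. - x i) UNIV"
    by (rule P.indep_vars_compose2[OF indep_coords]) simp
  then have "distr S (Pi\<^sub>M UNIV (\<lambda>_. borel)) (\<lambda>x. restrict (\<lambda>i. - x i) UNIV)
      = (\<Pi>\<^sub>M i\<in>UNIV. distr S borel (\<lambda>x. - x i))"
    by (subst (asm) P.indep_vars_iff_distr_eq_PiM') auto
  moreover have "distr S borel (\<lambda>x. - x i) = distr M borel uminus" for i
    using distr_distr[of uminus borel borel "\<lambda>x. x i" S] by (simp add: distr_coord comp_def)
  ultimately show ?thesis by (simp add: restrict_UNIV)
qed

lemma prob_ladder_uminus:
  "P.prob {x. ladder k (\<lambda>i. - x i)} = real_sequence_space.survival (distr M borel uminus) k"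
proof -
  interpret R: real_sequence_space "distr M borel uminus" by (rule real_sequence_space_uminus)
  have "R.survival k = measure (distr S (Pi\<^sub>M UNIV (\<lambda>_. borel)) (\<lambda>x i. - x i)) {x. ladder k x}"
    by (simp add: R.prob_ladder distr_uminus)
  also have "\<dots> = P.prob {x. ladder k (\<lambda>i. - x i)}"
  proof (subst measure_distr)
    show "{x. ladder k x} \<in> sets (Pi\<^sub>M UNIV (\<lambda>_. borel))"
      using Collect_in_sets[OF pred_ladder] by (simp cong: sets_PiM_cong)
    show "(\<lambda>x i. - x i) \<in> S \<rightarrow>\<^sub>M Pi\<^sub>M UNIV (\<lambda>_. borel)"
      by (rule measurable_PiM_single') auto
  qed (simp add: vimage_def)
  finally show ?thesis ..
qed

lemma max_decomposition:
  "1 \<le> (\<Sum>k\<le>n. P.prob {x. ladder k (\<lambda>i. - x i)} * survival (n - k))"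
proof -
  have uminus: "(\<lambda>x i. - x i) \<in> S \<rightarrow>\<^sub>M S" by (rule measurable_PiM_single') auto
  have meas [measurable]: "Measurable.pred S (\<lambda>x. ladder k (\<lambda>i. - x i))" for k
    by (rule measurable_compose[OF uminus pred_ladder])
  have meas2 [measurable]: "Measurable.pred S (\<lambda>x. below n (\<lambda>i. x (i + k)))" for k n
    by (rule measurable_compose[OF measurable_reindex pred_below])
  let ?E = "\<lambda>k. {x. ladder k (\<lambda>i. - x i) \<and> below (n - k) (\<lambda>i. x (i + k))}"
  have E: "?E k \<in> sets S" for k by (rule Collect_in_sets) measurable
  have prob: "P.prob (?E k) = P.prob {x. ladder k (\<lambda>i. - x i)} * survival (n - k)" for k
    unfolding survival_def
    using determined_ladder[of k]
    by (intro prob_prefix_suffix) (auto simp: determined_upto_def)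
  have "x \<in> (\<Union>k\<in>{..n}. ?E k)" for x
  proof -
    obtain k where k: "k \<le> n" "\<And>j. j \<le> n \<Longrightarrow> walk j x \<le> walk k x" using walk_attains_max[of n x] by blast
    have "walk j (\<lambda>i. x (i + k)) \<le> 0" if "j \<le> n - k" for j
      using k(2)[of "k + j"] k(1) that by (simp add: walk_add)
    then have "x \<in> ?E k" using k by (auto simp: ladder_uminus below_def)
    with k(1) show ?thesis by blast
  qed
  then have "(\<Union>k\<in>{..n}. ?E k) = space S" by auto
  then have "1 = P.prob (\<Union>k\<in>{..n}. ?E k)" using P.prob_space by simp
  also have "\<dots> \<le> (\<Sum>k\<le>n. P.prob (?E k))"
    using E by (intro P.finite_measure_subadditive_finite) auto
  finally show ?thesis by (simp only: prob)
qed

end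

context centered_walk
begin

lemma centered_walk_uminus: "centered_walk (distr M borel uminus)"
proof -
  interpret R: real_sequence_space "distr M borel uminus" by (rule real_sequence_space_uminus)
  have um: "uminus \<in> M \<rightarrow>\<^sub>M (borel :: real measure)"
    by (simp add: measurable_cong_sets[OF sets_M refl])
  have id: "(\<lambda>y. y) \<in> borel_measurable (borel :: real measure)"
    and sq: "(\<lambda>y. y\<^sup>2) \<in> borel_measurable (borel :: real measure)" by simp_all
  show ?thesis
  proof
    show "integrable (distr M borel uminus) (\<lambda>y. y)"
      unfolding integrable_distr_eq[OF um id] using integrable_id
      by (rule Bochner_Integration.integrable_minus)
    show "(\<integral>y. y \<partial>distr M borel uminus) = 0"
      unfolding integral_distr[OF um id] using mean_zero by simp
    show "integrable (distr M borel uminus) (\<lambda>y. y\<^sup>2)"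
      unfolding integrable_distr_eq[OF um sq] using integrable_square by simp
    have "{y \<in> space borel. y = (0::real)} \<in> sets borel" by simp
    then show "\<not> (AE y in distr M borel uminus. y = 0)"
      using nondegenerate by (simp add: AE_distr_iff[OF um])
  qed
qed

theorem survival_lower_bound: "\<exists>c>0. \<forall>n. c / sqrt (Suc n) \<le> survival n"
proof -
  interpret R: centered_walk "distr M borel uminus" by (rule centered_walk_uminus)
  obtain C1 where C1: "C1 > 0" "\<And>n. survival n \<le> C1 / sqrt (Suc n)"
    using survival_upper_bound by blast
  obtain C2 where C2: "C2 > 0" "\<And>n. R.survival n \<le> C2 / sqrt (Suc n)"
    using R.survival_upper_bound by blast
  define C where "C = max C1 C2"
  have C: "C > 0" "survival n \<le> C / sqrt (Suc n)" "R.survival n \<le> C / sqrt (Suc n)" for n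
  proof -
    show "C > 0" using C1 by (simp add: C_def)
    have "C1 / sqrt (Suc n) \<le> C / sqrt (Suc n)" "C2 / sqrt (Suc n) \<le> C / sqrt (Suc n)"
      by (auto simp: C_def intro!: divide_right_mono)
    then show "survival n \<le> C / sqrt (Suc n)" "R.survival n \<le> C / sqrt (Suc n)"
      using C1(2)[of n] C2(2)[of n] by linarith+
  qed
  obtain R where R: "real R \<ge> (4 * C\<^sup>2)\<^sup>2" using real_arch_simple by blast
  have "(1 / (4 * C * sqrt (R + 2))) / sqrt (Suc m) \<le> survival m" for m
  proof -
    define n where "n = (R + 1) * Suc m"
    have "m \<le> n" by (simp add: n_def)
    have "(\<Sum>k\<le>n. R.survival k * survival (n - k)) = (\<Sum>j\<le>n. R.survival (n - j) * survival j)"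
      by (rule sum.reindex_bij_witness[of _ "\<lambda>j. n - j" "\<lambda>j. n - j"]) auto
    also have "\<dots> =
        (\<Sum>j<m. R.survival (n - j) * survival j) + (\<Sum>j\<in>{m..n}. R.survival (n - j) * survival j)"
    proof -
      have "{..n} = {..<m} \<union> {m..n}" using \<open>m \<le> n\<close> by auto
      then show ?thesis by (simp add: sum.union_disjoint ivl_disj_int)
    qed
    also have "(\<Sum>j<m. R.survival (n - j) * survival j) \<le> 1 / 2"
    proof -
      have "(\<Sum>j<m. R.survival (n - j) * survival j)
          \<le> (\<Sum>j<m. (C / sqrt (R * Suc m + 1)) * (C / sqrt (Suc j)))"
      proof (intro sum_mono mult_mono survival_nonneg C)
        fix j assume "j \<in> {..<m}"
        then have "R * Suc m + 1 \<le> Suc (n - j)" by (simp add: n_def)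
        then have "sqrt (real (R * Suc m + 1)) \<le> sqrt (real (Suc (n - j)))"
          using of_nat_le_iff[where 'a=real] by (metis real_sqrt_le_iff)
        moreover have "0 < sqrt (real (R * Suc m + 1))" by (simp only: real_sqrt_gt_0_iff)
        ultimately have "C / sqrt (Suc (n - j)) \<le> C / sqrt (R * Suc m + 1)"
          using C(1) by (intro divide_left_mono) (simp_all del: of_nat_Suc of_nat_add of_nat_mult)
        then show "R.survival (n - j) \<le> C / sqrt (R * Suc m + 1)"
          using C(3)[of "n - j"] by linarith
      qed (use C in auto)
      also have "\<dots> = C\<^sup>2 / sqrt (R * Suc m + 1) * (\<Sum>j<m. 1 / sqrt (Suc j))"
        by (simp add: sum_distrib_left power2_eq_square)
      also have "\<dots> \<le> C\<^sup>2 / sqrt (R * Suc m + 1) * (2 * sqrt m)"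
        by (intro mult_left_mono sum_inverse_sqrt_le) auto
      also have "\<dots> \<le> 1 / 2"
      proof -
        have "4 * C\<^sup>2 * sqrt m \<le> sqrt (R * Suc m + 1)"
        proof (rule real_le_rsqrt)
          have "(4 * C\<^sup>2 * sqrt m)\<^sup>2 = (4 * C\<^sup>2)\<^sup>2 * m"
            by (simp add: power_mult_distrib)
          also have "\<dots> \<le> real R * m" using R by (rule mult_right_mono) simp
          finally show "(4 * C\<^sup>2 * sqrt m)\<^sup>2 \<le> R * Suc m + 1" by (simp add: algebra_simps)
        qed
        moreover have "0 < sqrt (real (R * Suc m + 1))" by (simp only: real_sqrt_gt_0_iff)
        ultimately show ?thesis by (simp add: field_simps)
      qed
      finally show ?thesis .
    qed
    also have "(\<Sum>j\<in>{m..n}. R.survival (n - j) * survival j) \<le> survival m * (2 * C * sqrt (Suc n))"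
    proof -
      have "(\<Sum>j\<in>{m..n}. R.survival (n - j) * survival j) \<le> (\<Sum>j\<in>{m..n}. R.survival (n - j) * survival m)"
        by (intro sum_mono mult_left_mono survival_antimono R.survival_nonneg) auto
      also have "\<dots> \<le> (\<Sum>j\<le>n. R.survival (n - j) * survival m)"
        by (rule sum_mono2) (auto simp: R.survival_nonneg survival_nonneg)
      also have "\<dots> = (\<Sum>k\<le>n. R.survival k * survival m)"
        by (rule sum.reindex_bij_witness[of _ "\<lambda>j. n - j" "\<lambda>j. n - j"]) auto
      also have "\<dots> \<le> (\<Sum>k\<le>n. (C / sqrt (Suc k)) * survival m)"
        by (intro sum_mono mult_right_mono C survival_nonneg)
      also have "\<dots> = survival m * C * (\<Sum>k<Suc n. 1 / sqrt (Suc k))"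
        by (simp only: sum_distrib_left lessThan_Suc_atMost) (simp add: mult_ac)
      also have "\<dots> \<le> survival m * C * (2 * sqrt (Suc n))"
        using C by (intro mult_left_mono sum_inverse_sqrt_le) (auto simp: survival_nonneg)
      finally show ?thesis by (simp add: mult_ac)
    qed
    finally have "1 \<le> 1 / 2 + survival m * (2 * C * sqrt (Suc n))"
      using max_decomposition[of n] by (simp add: prob_ladder_uminus)
    also have "\<dots> \<le> 1 / 2 + survival m * (2 * C * (sqrt (R + 2) * sqrt (Suc m)))"
    proof -
      have "sqrt (Suc n) \<le> sqrt (R + 2) * sqrt (Suc m)"
        unfolding real_sqrt_mult[symmetric] n_def by (simp add: algebra_simps)
      then show ?thesis using C(1) by (intro add_left_mono mult_left_mono survival_nonneg) auto
    qed
    finally show ?thesis using C(1) by (simp add: field_simps)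
  qed
  then show ?thesis using C(1) by (intro exI[of _ "1 / (4 * C * sqrt (R + 2))"]) auto
qed

end

context real_sequence_space
begin

lemma prob_stays_below_level:
  "survival T * P.prob {x. walk T x \<le> - h} * P.prob {x. \<forall>j\<le>N. walk j x \<le> h} \<le> survival N"
proof -
  have m1 [measurable]: "Measurable.pred S (\<lambda>x. \<forall>j\<le>N. walk j x \<le> h)" by measurable
  have m2 [measurable]: "Measurable.pred S (\<lambda>x. below T x \<and> walk T x \<le> - h)" by measurable
  have det: "determined_upto T (\<lambda>x. below T x \<and> walk T x \<le> - h)"
    unfolding determined_upto_def
  proof (intro allI impI)
    fix x y :: "nat \<Rightarrow> real" assume "\<forall>i<T. x i = y i"
    then have "walk T x = walk T y" "below T x = below T y"
      using determined_below[of T] by (auto simp: determined_upto_def intro: walk_cong)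
    then show "(below T x \<and> walk T x \<le> - h) = (below T y \<and> walk T y \<le> - h)" by simp
  qed
  have "survival T * P.prob {x. walk T x \<le> - h} \<le> P.prob {x. below T x \<and> walk T x \<le> - h}"
    unfolding survival_def
    by (intro harris_inequality[where n=T] antitone_below antitone_walk_le) auto
  then have "survival T * P.prob {x. walk T x \<le> - h} * P.prob {x. \<forall>j\<le>N. walk j x \<le> h}
      \<le> P.prob {x. below T x \<and> walk T x \<le> - h} * P.prob {x. \<forall>j\<le>N. walk j x \<le> h}"
    by (intro mult_right_mono) auto
  also have "\<dots> = P.prob {x. (below T x \<and> walk T x \<le> - h) \<and> (\<forall>j\<le>N. walk j (\<lambda>i. x (i + T)) \<le> h)}"
    by (rule prob_prefix_suffix[OF m2 m1 det, symmetric])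
  also have "\<dots> \<le> P.prob {x. below N x}"
  proof (rule P.finite_measure_mono)
    show "{x. (below T x \<and> walk T x \<le> - h) \<and> (\<forall>j\<le>N. walk j (\<lambda>i. x (i + T)) \<le> h)} \<subseteq> {x. below N x}"
    proof safe
      fix x assume x: "below T x" "walk T x \<le> - h" "\<forall>j\<le>N. walk j (\<lambda>i. x (i + T)) \<le> h"
      have "walk j x \<le> 0" if "j \<le> N" for j
      proof (cases "j \<le> T")
        case True
        with x show ?thesis by (simp add: below_def)
      next
        case False
        then have "walk j x = walk T x + walk (j - T) (\<lambda>i. x (i + T))"
          using walk_add[of T "j - T" x] by simp
        moreover have "walk (j - T) (\<lambda>i. x (i + T)) \<le> h" using x(3) that by simp
        ultimately show ?thesis using x(2) by linarith
      qed
      then show "below N x" by (simp add: below_def)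
    qed
  qed (rule Collect_in_sets, measurable)
  finally show ?thesis by (simp add: survival_def)
qed

end

subsection \<open>Comparing the autoregressive process with the walk\<close>

definition ar :: "real \<Rightarrow> nat \<Rightarrow> (nat \<Rightarrow> real) \<Rightarrow> real" where
  "ar a n x = ar2 (1 - a) a (\<lambda>i x. x (i - 1)) n x"

lemma ar_0 [simp]: "ar a 0 x = 0"
  by (simp add: ar_def)

lemma ar_Suc: "ar a (Suc n) x = walk (Suc n) x - a * ar a n x"
proof (induction n)
  case 0
  then show ?case by (simp add: ar_def walk_def)
next
  case (Suc n)
  have "ar a (Suc (Suc n)) x = (1 - a) * ar a (Suc n) x + a * ar a n x + x (Suc n)"
    by (simp add: ar_def)
  with Suc show ?case by (simp add: walk_Suc[of "Suc n"] algebra_simps)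
qed

lemma ar_diff: "ar a n (\<lambda>i. y i - x i) = ar a n y - ar a n x"
proof (induction n)
  case (Suc n)
  have "walk (Suc n) (\<lambda>i. y i - x i) = walk (Suc n) y - walk (Suc n) x"
    by (simp add: walk_def sum_subtractf)
  with Suc show ?case by (simp add: ar_Suc right_diff_distrib)
qed simp

lemma ar_nonneg:
  assumes "\<And>i. i < n \<Longrightarrow> 0 \<le> x i" and a: "a \<le> 1"
  shows "0 \<le> ar a n x"
proof (cases "a \<ge> 0")
  case True
  from assms(1) have "0 \<le> ar a n x \<and> ar a n x \<le> walk n x"
  proof (induction n)
    case (Suc n)
    then have IH: "0 \<le> ar a n x" "ar a n x \<le> walk n x" and xn: "0 \<le> x n" by auto
    have "a * ar a n x \<le> ar a n x" using IH a mult_right_mono[of a 1 "ar a n x"] by simp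
    with IH xn True show ?case by (simp add: ar_Suc walk_Suc)
  qed simp
  then show ?thesis ..
next
  case False
  from assms(1) show ?thesis
  proof (induction n)
    case (Suc n)
    have "0 \<le> walk (Suc n) x" unfolding walk_def using Suc.prems by (intro sum_nonneg) auto
    moreover have "a * ar a n x \<le> 0" using Suc False by (intro mult_nonpos_nonneg) auto
    ultimately show ?case by (simp add: ar_Suc)
  qed simp
qed

lemma ar_mono: "a \<le> 1 \<Longrightarrow> (\<And>i. i < n \<Longrightarrow> x i \<le> y i) \<Longrightarrow> ar a n x \<le> ar a n y"
  using ar_nonneg[of n "\<lambda>i. y i - x i" a] by (simp add: ar_diff)

lemma antitone_ar_le: "a \<le> 1 \<Longrightarrow> k \<le> n \<Longrightarrow> antitone_upto n (\<lambda>x. ar a k x \<le> c)"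
  unfolding antitone_upto_def
  by (intro allI impI le_boolI) (rule order_trans[OF ar_mono], auto)

lemma ar_increment_bound:
  assumes "\<bar>a\<bar> < 1" "\<And>i. i < n \<Longrightarrow> \<bar>x i\<bar> \<le> B" "0 \<le> B"
  shows "\<bar>ar a n x - ar a (n - 1) x\<bar> \<le> B / (1 - \<bar>a\<bar>)"
  using assms(2)
proof (induction n)
  case 0
  then show ?case using assms by simp
next
  case (Suc n)
  have "ar a (Suc n) x - ar a n x = x n - a * (ar a n x - ar a (n - 1) x)"
    by (cases n) (simp_all add: ar_Suc walk_Suc algebra_simps)
  then have "\<bar>ar a (Suc n) x - ar a n x\<bar> \<le> \<bar>x n\<bar> + \<bar>a\<bar> * \<bar>ar a n x - ar a (n - 1) x\<bar>"
    by (simp add: abs_mult[symmetric])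
  also have "\<dots> \<le> B + \<bar>a\<bar> * (B / (1 - \<bar>a\<bar>))"
    using Suc by (intro add_mono mult_left_mono) auto
  also have "\<dots> = B / (1 - \<bar>a\<bar>)" using assms(1) by (simp add: field_simps)
  finally show ?case by simp
qed

lemma ar_near_walk:
  assumes "\<bar>a\<bar> < 1" "\<And>i. i < n \<Longrightarrow> \<bar>x i\<bar> \<le> B" "0 \<le> B"
  shows "\<bar>(1 + a) * ar a n x - walk n x\<bar> \<le> B / (1 - \<bar>a\<bar>)"
proof -
  have "(1 + a) * ar a n x - walk n x = a * (ar a n x - ar a (n - 1) x)"
    by (cases n) (simp_all add: ar_Suc algebra_simps)
  then have "\<bar>(1 + a) * ar a n x - walk n x\<bar> = \<bar>a\<bar> * \<bar>ar a n x - ar a (n - 1) x\<bar>"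
    by (simp add: abs_mult)
  also have "\<dots> \<le> 1 * (B / (1 - \<bar>a\<bar>))"
    using assms by (intro mult_mono ar_increment_bound) auto
  finally show ?thesis by simp
qed

lemma ar_one_even: "ar 1 (2 * j) x = walk j (\<lambda>i. x (2 * i + 1))"
  and ar_one_odd: "ar 1 (Suc (2 * j)) x = walk (Suc j) (\<lambda>i. x (2 * i))"
proof (induction j)
  case 0
  { case 1 then show ?case by simp }
  { case 2 then show ?case by (simp add: ar_Suc walk_def) }
next
  case (Suc j)
  have step: "ar 1 (Suc (Suc n)) x = ar 1 n x + x (Suc n)" for n
    by (simp add: ar_def)
  { case 1 then show ?case using Suc step[of "2 * j"] by (simp add: walk_Suc) }
  { case 2 then show ?case using Suc step[of "Suc (2 * j)"] by (simp add: walk_Suc) }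
qed

context real_sequence_space
begin

lemma measurable_ar [measurable]: "ar a n \<in> borel_measurable S"
proof (induction n)
  case 0
  have "ar a 0 = (\<lambda>_. 0)" by auto
  then show ?case by simp
next
  case (Suc n)
  have "ar a (Suc n) = (\<lambda>x. walk (Suc n) x - a * ar a n x)" by (auto simp: ar_Suc)
  with Suc show ?case by simp
qed

definition ar_survival :: "real \<Rightarrow> nat \<Rightarrow> real" where
  "ar_survival a N = P.prob {x. \<forall>n\<le>N. ar a n x \<le> 0}"

lemma ar_survival_nonneg: "0 \<le> ar_survival a N"
  by (simp add: ar_survival_def)

lemma pred_ar_survival [measurable]: "Measurable.pred S (\<lambda>x. \<forall>n\<le>N. ar a n x \<le> 0)"
  by measurable

lemma ar_survival_one:
  "ar_survival 1 N = survival ((N + 1) div 2) * survival (N div 2)"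
proof -
  define m where "m = (N + 1) div 2"
  define \<pi> where "\<pi> = (\<lambda>i. if i < m then 2 * i else if i < 2 * m then 2 * (i - m) + 1 else i)"
  have "inj \<pi>"
    unfolding inj_on_def \<pi>_def by (auto split: if_splits; presburger)
  have shifted [measurable]: "Measurable.pred S (\<lambda>x. below (N div 2) (\<lambda>i. x (i + m)))"
    by (rule measurable_compose[OF measurable_reindex pred_below])
  have iff: "(below m (\<lambda>i. x (\<pi> i)) \<and> below (N div 2) (\<lambda>i. x (\<pi> (i + m)))) \<longleftrightarrow> (\<forall>n\<le>N. ar 1 n x \<le> 0)" for x
  proof -
    have "below m (\<lambda>i. x (\<pi> i)) = below m (\<lambda>i. x (2 * i))"
      using determined_below[of m] unfolding determined_upto_def \<pi>_def by auto
    also have "\<dots> \<longleftrightarrow> (\<forall>j. Suc (2 * j) \<le> N \<longrightarrow> ar 1 (Suc (2 * j)) x \<le> 0)"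
    proof
      assume "below m (\<lambda>i. x (2 * i))"
      then show "\<forall>j. Suc (2 * j) \<le> N \<longrightarrow> ar 1 (Suc (2 * j)) x \<le> 0"
        unfolding below_def ar_one_odd m_def by auto
    next
      assume odd: "\<forall>j. Suc (2 * j) \<le> N \<longrightarrow> ar 1 (Suc (2 * j)) x \<le> 0"
      have "walk j (\<lambda>i. x (2 * i)) \<le> 0" if "j \<le> m" for j
      proof (cases j)
        case (Suc i)
        then have "Suc (2 * i) \<le> N" using that by (simp add: m_def)
        with odd Suc show ?thesis by (metis ar_one_odd)
      qed simp
      then show "below m (\<lambda>i. x (2 * i))" by (simp add: below_def)
    qed
    finally have 1: "below m (\<lambda>i. x (\<pi> i)) \<longleftrightarrow> (\<forall>j. Suc (2 * j) \<le> N \<longrightarrow> ar 1 (Suc (2 * j)) x \<le> 0)" .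
    have "\<pi> (i + m) = 2 * i + 1" if "i < N div 2" for i
      using that by (auto simp: \<pi>_def m_def)
    then have "below (N div 2) (\<lambda>i. x (\<pi> (i + m))) = below (N div 2) (\<lambda>i. x (2 * i + 1))"
      using determined_below[of "N div 2"] unfolding determined_upto_def by auto
    also have "\<dots> \<longleftrightarrow> (\<forall>j. 2 * j \<le> N \<longrightarrow> ar 1 (2 * j) x \<le> 0)"
      unfolding below_def ar_one_even by auto
    finally have 2: "below (N div 2) (\<lambda>i. x (\<pi> (i + m))) \<longleftrightarrow> (\<forall>j. 2 * j \<le> N \<longrightarrow> ar 1 (2 * j) x \<le> 0)" .
    show ?thesis unfolding 1 2
    proof safe
      fix n assume "\<forall>j. Suc (2 * j) \<le> N \<longrightarrow> ar 1 (Suc (2 * j)) x \<le> 0"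
        "\<forall>j. 2 * j \<le> N \<longrightarrow> ar 1 (2 * j) x \<le> 0" "n \<le> N"
      then show "ar 1 n x \<le> 0"
        by (cases "even n") (auto elim!: evenE oddE)
    qed auto
  qed
  have "ar_survival 1 N = P.prob {x. below m (\<lambda>i. x (\<pi> i)) \<and> below (N div 2) (\<lambda>i. x (\<pi> (i + m)))}"
    unfolding ar_survival_def iff ..
  also have "\<dots> = P.prob {x. below m x \<and> below (N div 2) (\<lambda>i. x (i + m))}"
    by (rule prob_reindex[OF \<open>inj \<pi>\<close>]) measurable
  also have "\<dots> = survival m * survival (N div 2)"
    unfolding survival_def by (intro prob_prefix_suffix pred_below determined_below)
  finally show ?thesis by (simp add: m_def)
qed

lemma ar_survival_ge_power:
  assumes "a \<le> 1"
  shows "M.prob {y. y \<le> 0} ^ N \<le> ar_survival a N"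
proof -
  have anti: "antitone_upto n (\<lambda>x. x i \<le> 0)" if "i < n" for i n
    using that by (auto simp: antitone_upto_def intro: order_trans)
  have "M.prob {y. y \<le> 0} ^ N \<le> P.prob {x. \<forall>i. i < N \<longrightarrow> x i \<le> 0}"
  proof (induction N)
    case 0
    then show ?case using P.prob_space by simp
  next
    case (Suc N)
    have "M.prob {y. y \<le> 0} ^ Suc N \<le> P.prob {x. \<forall>i. i < N \<longrightarrow> x i \<le> 0} * P.prob {x. x N \<le> 0}"
      using Suc prob_coord[of "\<lambda>y. y \<le> 0" N] by (simp add: mult.commute mult_left_mono)
    also have "\<dots> \<le> P.prob {x. (\<forall>i. i < N \<longrightarrow> x i \<le> 0) \<and> x N \<le> 0}"
      by (intro harris_inequality[where n="Suc N"] antitone_all anti) auto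
    also have "{x. (\<forall>i. i < N \<longrightarrow> x i \<le> 0) \<and> x N \<le> (0::real)} = {x. \<forall>i. i < Suc N \<longrightarrow> x i \<le> 0}"
      by (auto simp: less_Suc_eq)
    finally show ?case .
  qed
  also have "\<dots> \<le> ar_survival a N"
    unfolding ar_survival_def
  proof (rule P.finite_measure_mono)
    have "ar a n x \<le> 0" if "\<forall>i. i < N \<longrightarrow> x i \<le> 0" "n \<le> N" for n x
    proof -
      have "ar a n x \<le> ar a n (\<lambda>_. 0)" using that assms by (intro ar_mono) auto
      also have "\<dots> = 0" by (induction n) (simp_all add: ar_Suc walk_def)
      finally show ?thesis .
    qed
    then show "{x. \<forall>i. i < N \<longrightarrow> x i \<le> 0} \<subseteq> {x. \<forall>n\<le>N. ar a n x \<le> 0}" by auto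
  qed (rule Collect_in_sets, measurable)
  finally show ?thesis .
qed

lemma ar_survival_le:
  assumes a: "\<bar>a\<bar> < 1" and "0 \<le> B"
  shows "ar_survival a N \<le> P.prob {x. \<forall>j\<le>N. walk j x \<le> B / (1 - \<bar>a\<bar>)} + P.prob {x. \<exists>i<N. B < \<bar>x i\<bar>}"
proof -
  let ?A = "{x. \<forall>j\<le>N. walk j x \<le> B / (1 - \<bar>a\<bar>)}" and ?B = "{x. \<exists>i<N. B < \<bar>x i\<bar>}"
  have sets: "?A \<in> sets S" "?B \<in> sets S" by (rule Collect_in_sets; measurable)+
  have "{x. \<forall>n\<le>N. ar a n x \<le> 0} \<subseteq> ?A \<union> ?B"
  proof
    fix x assume x: "x \<in> {x. \<forall>n\<le>N. ar a n x \<le> 0}"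
    show "x \<in> ?A \<union> ?B"
    proof (cases "x \<in> ?B")
      case False
      then have small: "\<bar>x i\<bar> \<le> B" if "i < N" for i using that by force
      have "walk j x \<le> B / (1 - \<bar>a\<bar>)" if "j \<le> N" for j
      proof -
        have "\<bar>(1 + a) * ar a j x - walk j x\<bar> \<le> B / (1 - \<bar>a\<bar>)"
          using a \<open>0 \<le> B\<close> that by (intro ar_near_walk small) auto
        moreover have "(1 + a) * ar a j x \<le> 0"
          using x that a by (intro mult_nonneg_nonpos) auto
        ultimately show ?thesis by linarith
      qed
      then show ?thesis by auto
    qed auto
  qed
  then have "ar_survival a N \<le> P.prob (?A \<union> ?B)"
    unfolding ar_survival_def using sets by (intro P.finite_measure_mono) auto
  also have "\<dots> \<le> P.prob ?A + P.prob ?B" by (rule measure_Un_le[OF sets])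
  finally show ?thesis .
qed

lemma ar_survival_ge:
  assumes a: "\<bar>a\<bar> < 1" and "0 \<le> B"
  shows "ar_survival a T * (P.prob {x. walk T x \<le> - (B / (1 - \<bar>a\<bar>))} * survival N
    - P.prob {x. \<exists>i<N. B < \<bar>x i\<bar>}) \<le> ar_survival a N"
proof -
  define h where "h = B / (1 - \<bar>a\<bar>)"
  let ?late = "\<lambda>x. \<forall>n. T < n \<and> n \<le> N \<longrightarrow> ar a n x \<le> 0"
  have late [measurable]: "Measurable.pred S ?late" by measurable
  let ?A = "{x. walk T x \<le> - h \<and> below N (\<lambda>i. x (i + T))}" and ?B = "{x. \<exists>i<N. B < \<bar>x i\<bar>}"
  have shifted [measurable]: "Measurable.pred S (\<lambda>x. below N (\<lambda>i. x (i + T)))"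
    by (rule measurable_compose[OF measurable_reindex pred_below])
  have sets: "?A \<in> sets S" "?B \<in> sets S" "{x. ?late x} \<in> sets S"
    by (rule Collect_in_sets; measurable)+
  have "?A \<subseteq> {x. ?late x} \<union> ?B"
  proof
    fix x assume x: "x \<in> ?A"
    show "x \<in> {x. ?late x} \<union> ?B"
    proof (cases "x \<in> ?B")
      case False
      then have small: "\<bar>x i\<bar> \<le> B" if "i < N" for i using that by force
      have "ar a n x \<le> 0" if n: "T < n" "n \<le> N" for n
      proof -
        have near: "\<bar>(1 + a) * ar a n x - walk n x\<bar> \<le> h"
          unfolding h_def using a \<open>0 \<le> B\<close> that by (intro ar_near_walk small) auto
        have "walk n x = walk T x + walk (n - T) (\<lambda>i. x (i + T))"
          using walk_add[of T "n - T" x] n by simp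
        moreover have "walk (n - T) (\<lambda>i. x (i + T)) \<le> 0" using x n by (auto simp: below_def)
        moreover have "walk T x \<le> - h" using x by simp
        ultimately have "(1 + a) * ar a n x \<le> 0" using near by linarith
        then show ?thesis using a by (auto simp: mult_le_0_iff)
      qed
      then show ?thesis by blast
    qed auto
  qed
  then have "P.prob ?A \<le> P.prob ({x. ?late x} \<union> ?B)"
    using sets by (intro P.finite_measure_mono) auto
  also have "\<dots> \<le> P.prob {x. ?late x} + P.prob ?B"
    using sets by (intro measure_Un_le)
  finally have "P.prob ?A - P.prob ?B \<le> P.prob {x. ?late x}" by simp
  moreover have "P.prob ?A = P.prob {x. walk T x \<le> - h} * survival N"
    unfolding survival_def
  proof (rule prob_prefix_suffix)
    show "determined_upto T (\<lambda>x. walk T x \<le> - h)"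
      unfolding determined_upto_def
    proof (intro allI impI)
      fix x y :: "nat \<Rightarrow> real" assume "\<forall>i<T. x i = y i"
      then have "walk T x = walk T y" by (rule walk_cong_upto) simp
      then show "(walk T x \<le> - h) = (walk T y \<le> - h)" by simp
    qed
  qed measurable
  ultimately have "ar_survival a T * (P.prob {x. walk T x \<le> - h} * survival N - P.prob ?B)
      \<le> ar_survival a T * P.prob {x. ?late x}"
    using ar_survival_nonneg by (intro mult_left_mono) auto
  also have "\<dots> \<le> P.prob {x. (\<forall>n\<le>T. ar a n x \<le> 0) \<and> ?late x}"
    unfolding ar_survival_def using a
    by (intro harris_inequality[where n="max T N"] antitone_all antitone_ar_le pred_ar_survival late) auto
  also have "\<dots> \<le> ar_survival a N"
    unfolding ar_survival_def
    by (intro P.finite_measure_mono Collect_in_sets pred_ar_survival) (auto simp: not_less[symmetric])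
  finally show ?thesis by (simp add: h_def)
qed

lemma prob_large_innovation:
  fixes N :: nat
  assumes int: "integrable M (\<lambda>y. exp (\<bar>y\<bar> powr \<alpha>))" and "\<alpha> > 0" "0 \<le> B"
  shows "P.prob {x. \<exists>i<N. B < \<bar>x i\<bar>} \<le> real N * (M.expectation (\<lambda>y. exp (\<bar>y\<bar> powr \<alpha>)) / exp (B powr \<alpha>))"
proof -
  have "P.prob {x. \<exists>i<N. B < \<bar>x i\<bar>} = P.prob (\<Union>i\<in>{..<N}. {x :: nat \<Rightarrow> real. B < \<bar>x i\<bar>})"
    by (rule arg_cong[where f=P.prob]) auto
  also have "\<dots> \<le> (\<Sum>i<N. P.prob {x. B < \<bar>x i\<bar>})"
    by (intro P.finite_measure_subadditive_finite) (auto intro!: Collect_in_sets)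
  also have "\<dots> = (\<Sum>i<N. M.prob {y. B < \<bar>y\<bar>})"
    by (intro sum.cong refl prob_coord) measurable
  also have "\<dots> = real N * M.prob {y. B < \<bar>y\<bar>}" by simp
  also have "\<dots> \<le> real N * (M.expectation (\<lambda>y. exp (\<bar>y\<bar> powr \<alpha>)) / exp (B powr \<alpha>))"
  proof (rule mult_left_mono)
    have "M.prob {y. B < \<bar>y\<bar>} \<le> M.prob {y \<in> space M. exp (B powr \<alpha>) \<le> exp (\<bar>y\<bar> powr \<alpha>)}"
      using assms by (intro M.finite_measure_mono) (auto intro!: powr_mono2)
    also have "\<dots> \<le> M.expectation (\<lambda>y. exp (\<bar>y\<bar> powr \<alpha>)) / exp (B powr \<alpha>)"
      using int by (intro integral_Markov_inequality_measure[where A="{}"]) auto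
    finally show "M.prob {y. B < \<bar>y\<bar>} \<le> M.expectation (\<lambda>y. exp (\<bar>y\<bar> powr \<alpha>)) / exp (B powr \<alpha>)" .
  qed simp
  finally show ?thesis .
qed

end

subsection \<open>Survival exponents\<close>

lemma square_le_exp_powr:
  fixes \<alpha> :: real
  assumes "\<alpha> > 0"
  obtains C where "\<And>y. y\<^sup>2 \<le> C * exp (\<bar>y\<bar> powr \<alpha>)"
proof
  fix y :: real
  define m where "m = nat \<lceil>2 / \<alpha>\<rceil>"
  have m: "2 \<le> \<alpha> * real m"
  proof -
    have "2 / \<alpha> \<le> real m" unfolding m_def by linarith
    then show ?thesis using assms by (simp add: field_simps)
  qed
  have "(\<bar>y\<bar> powr \<alpha>) ^ m / fact m \<le> exp (\<bar>y\<bar> powr \<alpha>)"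
  proof -
    have "(\<bar>y\<bar> powr \<alpha>) ^ m / fact m = (\<Sum>k\<in>{m}. (\<bar>y\<bar> powr \<alpha>) ^ k /\<^sub>R fact k)"
      by (simp add: divide_inverse mult.commute)
    also have "\<dots> \<le> (\<Sum>k. (\<bar>y\<bar> powr \<alpha>) ^ k /\<^sub>R fact k)"
      by (rule sum_le_suminf[OF summable_exp_generic]) auto
    finally show ?thesis by (simp add: exp_def)
  qed
  then have pow: "(\<bar>y\<bar> powr \<alpha>) ^ m \<le> fact m * exp (\<bar>y\<bar> powr \<alpha>)"
    by (simp add: field_simps)
  show "y\<^sup>2 \<le> (1 + fact m) * exp (\<bar>y\<bar> powr \<alpha>)"
  proof (cases "\<bar>y\<bar> \<le> 1")
    case True
    then have "y\<^sup>2 \<le> 1" by (simp add: abs_square_le_1)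
    also have "\<dots> \<le> exp (\<bar>y\<bar> powr \<alpha>)" by simp
    also have "\<dots> \<le> (1 + fact m) * exp (\<bar>y\<bar> powr \<alpha>)" by (simp add: algebra_simps)
    finally show ?thesis .
  next
    case False
    then have "y\<^sup>2 = \<bar>y\<bar> powr 2" by simp
    also have "\<dots> \<le> \<bar>y\<bar> powr (\<alpha> * real m)" using False m by (intro powr_mono) auto
    also have "\<dots> = (\<bar>y\<bar> powr \<alpha>) ^ m"
      using False by (simp add: powr_powr[symmetric] powr_realpow)
    also have "\<dots> \<le> (1 + fact m) * exp (\<bar>y\<bar> powr \<alpha>)" using pow by (simp add: distrib_right add_increasing)
    finally show ?thesis .
  qed
qed

context centered_walk
begin

theorem ar_survival_one_bigtheta: "ar_survival 1 \<in> \<Theta>(\<lambda>N. 1 / real N)"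
proof -
  obtain c where c: "c > 0" "\<And>n. c / sqrt (Suc n) \<le> survival n" using survival_lower_bound by blast
  obtain C where C: "C > 0" "\<And>n. survival n \<le> C / sqrt (Suc n)" using survival_upper_bound by blast
  have sandwich: "N / 2 \<le> sqrt (Suc ((N + 1) div 2)) * sqrt (Suc (N div 2))"
    "sqrt (Suc ((N + 1) div 2)) * sqrt (Suc (N div 2)) \<le> 2 * N" if "N \<ge> 1" for N :: nat
  proof -
    have "real N / 2 \<le> Suc (N div 2)" "real N / 2 \<le> Suc ((N + 1) div 2)" by linarith+
    then have "(real N / 2)\<^sup>2 \<le> real (Suc ((N + 1) div 2)) * real (Suc (N div 2))"
      unfolding power2_eq_square by (intro mult_mono) auto
    then show "N / 2 \<le> sqrt (Suc ((N + 1) div 2)) * sqrt (Suc (N div 2))"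
      unfolding real_sqrt_mult[symmetric] by (rule real_le_rsqrt)
    have "Suc (N div 2) \<le> 2 * N" "Suc ((N + 1) div 2) \<le> 2 * N" using that by linarith+
    then have "real (Suc ((N + 1) div 2)) * real (Suc (N div 2)) \<le> real (2 * N) * real (2 * N)"
      by (intro mult_mono) (simp_all only: of_nat_le_iff of_nat_0_le_iff)
    then show "sqrt (Suc ((N + 1) div 2)) * sqrt (Suc (N div 2)) \<le> 2 * N"
      unfolding real_sqrt_mult[symmetric] by (intro real_le_lsqrt) (auto simp: power2_eq_square)
  qed
  show ?thesis
  proof (rule bigthetaI)
    show "ar_survival 1 \<in> O(\<lambda>N. 1 / real N)"
    proof (rule bigoI[where c="2 * C\<^sup>2"])
      show "\<forall>\<^sub>F N in at_top. norm (ar_survival 1 N) \<le> 2 * C\<^sup>2 * norm (1 / real N)"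
        using eventually_ge_at_top[of 1]
      proof eventually_elim
        case (elim N)
        have "ar_survival 1 N \<le> (C / sqrt (Suc ((N + 1) div 2))) * (C / sqrt (Suc (N div 2)))"
          unfolding ar_survival_one by (intro mult_mono C survival_nonneg) (use C in auto)
        also have "\<dots> = C\<^sup>2 / (sqrt (Suc ((N + 1) div 2)) * sqrt (Suc (N div 2)))"
          by (simp add: power2_eq_square)
        also have "\<dots> \<le> C\<^sup>2 / (N / 2)"
          using sandwich(1)[OF elim] elim by (intro divide_left_mono) auto
        finally show ?case by (simp add: ar_survival_nonneg mult.commute)
      qed
    qed
    show "ar_survival 1 \<in> \<Omega>(\<lambda>N. 1 / real N)"
    proof (rule landau_omega.bigI[where c="c\<^sup>2 / 2"])
      show "\<forall>\<^sub>F N in at_top. norm (ar_survival 1 N) \<ge> c\<^sup>2 / 2 * norm (1 / real N)"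
        using eventually_ge_at_top[of 1]
      proof eventually_elim
        case (elim N)
        have "c\<^sup>2 / (2 * N) \<le> c\<^sup>2 / (sqrt (Suc ((N + 1) div 2)) * sqrt (Suc (N div 2)))"
          using sandwich(2)[OF elim] elim by (intro divide_left_mono) auto
        also have "\<dots> = (c / sqrt (Suc ((N + 1) div 2))) * (c / sqrt (Suc (N div 2)))"
          by (simp add: power2_eq_square)
        also have "\<dots> \<le> ar_survival 1 N"
          unfolding ar_survival_one by (intro mult_mono c survival_nonneg) (use c in auto)
        finally show ?case by (simp add: ar_survival_nonneg)
      qed
    qed (use c in simp)
  qed
qed

lemma ar_survival_pos:
  assumes "a \<le> 1"
  shows "0 < ar_survival a N" and "0 < M.prob {y. y \<le> 0}"
proof -
  obtain \<delta> where "\<delta> > 0" "M.prob {y. y < - \<delta>} > 0" using negative_step by blast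
  moreover from this have "M.prob {y. y < - \<delta>} \<le> M.prob {y. y \<le> 0}"
    by (intro M.finite_measure_mono) auto
  ultimately show *: "0 < M.prob {y. y \<le> 0}" by linarith
  then have "0 < M.prob {y. y \<le> 0} ^ N" by simp
  also have "\<dots> \<le> ar_survival a N" using assms by (rule ar_survival_ge_power)
  finally show "0 < ar_survival a N" .
qed

text \<open>For \<open>\<alpha> \<le> 1\<close> a run of \<open>T N\<close> negative innovations is too unlikely to start the lower bound.
  Hence the recursion \<open>ar_survival a N \<ge> ar_survival a (T N) * b0 / \<surd>N\<close> is applied twice
  before the exponential bound for \<open>T (T N)\<close>, a power of \<open>ln (ln N)\<close>, is used.\<close>

theorem ar_survival_exponent:
  assumes a: "\<bar>a\<bar> < 1" and \<alpha>: "\<alpha> > 0" and int: "integrable M (\<lambda>y. exp (\<bar>y\<bar> powr \<alpha>))"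
  shows "(\<lambda>N. ln (ar_survival a N) / ln (real N) + 1 / 2) \<longlonglongrightarrow> 0"
proof -
  obtain c0 where c0: "c0 > 0" "\<And>n. c0 / sqrt (Suc n) \<le> survival n" using survival_lower_bound by blast
  obtain C where C: "C > 0" "\<And>n. survival n \<le> C / sqrt (Suc n)" using survival_upper_bound by blast
  obtain c where c: "c > 0" "\<forall>\<^sub>F n in sequentially. c \<le> P.prob {x. walk n x \<le> - (\<sigma> * sqrt n)}"
    using walk_very_negative by blast
  then obtain m where m: "c \<le> P.prob {x. walk n x \<le> - (\<sigma> * sqrt n)}" if "n \<ge> m" for n
    by (auto simp: eventually_at_top_linorder)
  define K where "K = M.expectation (\<lambda>y. exp (\<bar>y\<bar> powr \<alpha>))"
  have "K \<ge> 0" by (simp add: K_def)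
  define \<beta> where "\<beta> = 2 / \<alpha>"
  have "\<beta> > 0" using \<alpha> by (simp add: \<beta>_def)
  define \<kappa> where "\<kappa> = (1 / ((1 - \<bar>a\<bar>) * \<sigma>))\<^sup>2"
  have "\<kappa> > 0" using a sigma_pos by (simp add: \<kappa>_def)
  define B where "B = (\<lambda>N::nat. (3 * ln (real N)) powr (1 / \<alpha>))"
  define T where "T = (\<lambda>N::nat. nat \<lceil>\<kappa> * (3 * ln (real N)) powr \<beta>\<rceil> + Suc m)"
  have B_nonneg: "0 \<le> B N" for N by (simp add: B_def)

  have down: "c \<le> P.prob {x. walk (T N) x \<le> - (B N / (1 - \<bar>a\<bar>))}" for N
  proof -
    have "(B N / ((1 - \<bar>a\<bar>) * \<sigma>))\<^sup>2 = \<kappa> * (3 * ln (real N)) powr \<beta>"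
      by (simp add: \<kappa>_def B_def \<beta>_def power_divide power2_eq_square powr_add[symmetric])
    also have "\<dots> \<le> T N" unfolding T_def by linarith
    finally have "B N / ((1 - \<bar>a\<bar>) * \<sigma>) \<le> sqrt (T N)" by (rule real_le_rsqrt)
    then have "B N / (1 - \<bar>a\<bar>) \<le> \<sigma> * sqrt (T N)"
      using a sigma_pos by (simp add: field_simps)
    then have "P.prob {x. walk (T N) x \<le> - (\<sigma> * sqrt (T N))} \<le> P.prob {x. walk (T N) x \<le> - (B N / (1 - \<bar>a\<bar>))}"
      by (intro P.finite_measure_mono Collect_in_sets) auto
    moreover have "T N \<ge> m" by (simp add: T_def)
    ultimately show ?thesis using m by (meson order_trans)
  qed
  have tail: "P.prob {x. \<exists>i<N. B N < \<bar>x i\<bar>} \<le> K / (real N)\<^sup>2" if "N \<ge> 1" for N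
  proof -
    have "exp (B N powr \<alpha>) = exp (3 * ln (real N))"
      using that \<alpha> by (simp add: B_def powr_powr)
    also have "\<dots> = real N ^ 3"
      using that exp_of_nat_mult[of 3 "ln (real N)"] by simp
    finally show ?thesis
      using prob_large_innovation[OF int \<alpha> B_nonneg[of N], of N] that
      by (simp add: K_def power3_eq_cube power2_eq_square)
  qed

  define A where "A = C / (c0 * c) + K"
  have "A > 0" using C c0 c \<open>K \<ge> 0\<close> by (simp add: A_def add_pos_nonneg)
  have upper: "ar_survival a N \<le> A * sqrt (Suc (T N)) / sqrt N" if "N \<ge> 1" for N
  proof -
    let ?Q = "P.prob {x. \<forall>j\<le>N. walk j x \<le> B N / (1 - \<bar>a\<bar>)}"
    have "(c0 / sqrt (Suc (T N))) * c * ?Q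
        \<le> survival (T N) * P.prob {x. walk (T N) x \<le> - (B N / (1 - \<bar>a\<bar>))} * ?Q"
      using c0 c by (intro mult_mono down) (auto simp: survival_nonneg)
    also have "\<dots> \<le> survival N" by (rule prob_stays_below_level)
    also have "\<dots> \<le> C / sqrt (Suc N)" by (rule C)
    also have "\<dots> \<le> C / sqrt N" using that C by (intro divide_left_mono) auto
    finally have "?Q \<le> (C / sqrt N) / ((c0 / sqrt (Suc (T N))) * c)"
      using c0(1) c(1) by (subst pos_le_divide_eq) (simp_all add: mult.commute)
    then have Q: "?Q \<le> C / (c0 * c) * sqrt (Suc (T N)) / sqrt N" by (simp add: mult_ac)
    have "K / (real N)\<^sup>2 \<le> K * sqrt (Suc (T N)) / sqrt N"
    proof -
      have "sqrt N \<le> sqrt (Suc (T N)) * (real N)\<^sup>2"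
      proof -
        have "sqrt N \<le> real N" using that by (intro real_le_lsqrt) (auto simp: power2_eq_square)
        also have "\<dots> \<le> (real N)\<^sup>2" using that by (simp add: power2_eq_square)
        also have "\<dots> \<le> sqrt (Suc (T N)) * (real N)\<^sup>2"
          using mult_right_mono[of 1 "sqrt (Suc (T N))" "(real N)\<^sup>2"] by simp
        finally show ?thesis .
      qed
      then have "K * sqrt N \<le> K * (sqrt (Suc (T N)) * (real N)\<^sup>2)"
        using \<open>K \<ge> 0\<close> by (rule mult_left_mono)
      then show ?thesis using that by (simp add: field_simps)
    qed
    with Q tail[OF that] ar_survival_le[OF a B_nonneg, of N N]
    have "ar_survival a N \<le> C / (c0 * c) * sqrt (Suc (T N)) / sqrt N + K * sqrt (Suc (T N)) / sqrt N"
      by linarith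
    also have "\<dots> = A * sqrt (Suc (T N)) / sqrt N"
      by (simp add: A_def add_divide_distrib distrib_right)
    finally show ?thesis .
  qed

  define b0 where "b0 = c * c0 / 2"
  have "b0 > 0" using c c0 by (simp add: b0_def)
  have "\<forall>\<^sub>F N in sequentially. b0 / sqrt (real N) \<le> 2 * b0 / sqrt (real N + 1) - K / (real N)\<^sup>2"
    using \<open>b0 > 0\<close> by real_asymp
  then have lower: "\<forall>\<^sub>F N in sequentially. ar_survival a (T N) * (b0 / sqrt N) \<le> ar_survival a N"
    using eventually_ge_at_top[of 1]
  proof eventually_elim
    case (elim N)
    have "2 * b0 / sqrt (real N + 1) = c * (c0 / sqrt (Suc N))" by (simp add: b0_def add.commute)
    also have "\<dots> \<le> P.prob {x. walk (T N) x \<le> - (B N / (1 - \<bar>a\<bar>))} * survival N"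
      using c c0 by (intro mult_mono down) auto
    finally have "b0 / sqrt N \<le> P.prob {x. walk (T N) x \<le> - (B N / (1 - \<bar>a\<bar>))} * survival N
        - P.prob {x. \<exists>i<N. B N < \<bar>x i\<bar>}"
      using elim tail[of N] by linarith
    then have "ar_survival a (T N) * (b0 / sqrt N) \<le> ar_survival a (T N) *
       (P.prob {x. walk (T N) x \<le> - (B N / (1 - \<bar>a\<bar>))} * survival N - P.prob {x. \<exists>i<N. B N < \<bar>x i\<bar>})"
      by (rule mult_left_mono) (rule ar_survival_nonneg)
    also have "\<dots> \<le> ar_survival a N" by (rule ar_survival_ge[OF a B_nonneg])
    finally show ?case .
  qed

  have T_lim: "filterlim T at_top sequentially"
  proof -
    have "filterlim (\<lambda>N::nat. \<kappa> * (3 * ln (real N)) powr \<beta>) at_top sequentially"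
      using \<open>\<kappa> > 0\<close> \<open>\<beta> > 0\<close> by real_asymp
    then have "filterlim (\<lambda>N. real (T N)) at_top sequentially"
    proof (rule filterlim_at_top_mono)
      show "\<forall>\<^sub>F N in sequentially. \<kappa> * (3 * ln (real N)) powr \<beta> \<le> real (T N)"
        by (intro always_eventually allI) (unfold T_def, linarith)
    qed
    then show ?thesis by (simp add: filterlim_sequentially_iff_filterlim_real)
  qed
  define b where "b = \<beta> + 1"
  have "b > 0" using \<open>\<beta> > 0\<close> by (simp add: b_def)
  have T_le: "\<forall>\<^sub>F N in sequentially. real (T N) \<le> ln (real N) powr b"
  proof -
    have "\<forall>\<^sub>F N in sequentially. \<kappa> * (3 * ln (real N)) powr \<beta> + 2 + real m \<le> ln (real N) powr b"
      unfolding b_def using \<open>\<kappa> > 0\<close> \<open>\<beta> > 0\<close> by real_asymp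
    then show ?thesis
    proof eventually_elim
      case (elim N)
      have "0 \<le> \<kappa> * (3 * ln (real N)) powr \<beta>" using \<open>\<kappa> > 0\<close> by simp
      then have "real (T N) \<le> \<kappa> * (3 * ln (real N)) powr \<beta> + 2 + real m"
        unfolding T_def by linarith
      with elim show ?case by linarith
    qed
  qed
  define \<rho> where "\<rho> = M.prob {y. y \<le> 0}"
  have \<rho>: "0 < \<rho>" "\<rho> \<le> 1" using ar_survival_pos(2)[of a] a by (auto simp: \<rho>_def)
  have pos: "0 < ar_survival a N" for N using ar_survival_pos(1)[of a] a by auto

  define U where "U = (\<lambda>N::nat. (ln A + 1 / 2 * ln (ln (real N) powr b + 1)) / ln (real N))"
  define V where "V = (\<lambda>N::nat. (2 * ln b0 - 1 / 2 * ln (ln (real N) powr b) + (b * ln (ln (real N))) powr b * ln \<rho>) / ln (real N))"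
  have "U \<longlonglongrightarrow> 0" unfolding U_def using \<open>b > 0\<close> by real_asymp
  have "V \<longlonglongrightarrow> 0" unfolding V_def using \<open>b > 0\<close> by real_asymp
  have "\<forall>\<^sub>F N in sequentially. ln (ar_survival a N) / ln (real N) + 1 / 2 \<le> U N"
    using T_le eventually_ge_at_top[of 2]
  proof eventually_elim
    case (elim N)
    have "ln (ar_survival a N) \<le> ln (A * sqrt (Suc (T N)) / sqrt N)"
      using upper[of N] elim pos \<open>A > 0\<close> by (subst ln_le_cancel_iff) (auto intro!: divide_pos_pos mult_pos_pos)
    also have "\<dots> = ln A + 1 / 2 * ln (real (T N) + 1) - 1 / 2 * ln (real N)"
      using \<open>A > 0\<close> elim by (simp add: ln_div ln_mult ln_sqrt add.commute)
    also have "\<dots> \<le> ln A + 1 / 2 * ln (ln (real N) powr b + 1) - 1 / 2 * ln (real N)"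
      using elim by simp
    finally have "ln (ar_survival a N) + 1 / 2 * ln (real N) \<le> ln A + 1 / 2 * ln (ln (real N) powr b + 1)"
      by simp
    moreover have "0 < ln (real N)" using elim by simp
    moreover from this have "ln (ar_survival a N) / ln (real N) + 1 / 2
        = (ln (ar_survival a N) + 1 / 2 * ln (real N)) / ln (real N)"
      by (simp add: add_divide_distrib)
    ultimately show ?case unfolding U_def by (simp add: divide_right_mono)
  qed
  moreover have "\<forall>\<^sub>F N in sequentially. V N \<le> ln (ar_survival a N) / ln (real N) + 1 / 2"
    using T_le lower filterlim_iff[THEN iffD1, OF T_lim, rule_format, OF T_le]
      filterlim_iff[THEN iffD1, OF T_lim, rule_format, OF lower] eventually_ge_at_top[of 2]
  proof eventually_elim
    case (elim N)
    have T_pos: "real (T N) \<ge> 1" "real (T N) > 0" by (simp_all add: T_def)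
    have logN: "0 < ln (real N)" using elim by simp
    have lnT: "ln (real (T N)) \<le> ln (ln (real N) powr b)"
      using elim(1) T_pos by (intro iffD2[OF ln_le_cancel_iff]) linarith+
    have "\<rho> ^ T (T N) * (b0 / sqrt (T N)) * (b0 / sqrt N) \<le> ar_survival a N"
    proof -
      have "\<rho> ^ T (T N) * (b0 / sqrt (T N)) \<le> ar_survival a (T (T N)) * (b0 / sqrt (T N))"
        using ar_survival_ge_power[of a "T (T N)"] a \<open>b0 > 0\<close> unfolding \<rho>_def
        by (intro mult_right_mono) auto
      also have "\<dots> \<le> ar_survival a (T N)" using elim by simp
      finally have "\<rho> ^ T (T N) * (b0 / sqrt (T N)) * (b0 / sqrt N) \<le> ar_survival a (T N) * (b0 / sqrt N)"
        using \<open>b0 > 0\<close> by (intro mult_right_mono) auto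
      also have "\<dots> \<le> ar_survival a N" using elim by simp
      finally show ?thesis .
    qed
    then have "ln (\<rho> ^ T (T N) * (b0 / sqrt (T N)) * (b0 / sqrt N)) \<le> ln (ar_survival a N)"
      using \<open>b0 > 0\<close> \<rho> T_pos elim by (subst ln_le_cancel_iff) (auto intro!: mult_pos_pos divide_pos_pos pos)
    moreover have "ln (\<rho> ^ T (T N) * (b0 / sqrt (T N)) * (b0 / sqrt N))
        = real (T (T N)) * ln \<rho> + (ln b0 - 1 / 2 * ln (real (T N))) + (ln b0 - 1 / 2 * ln (real N))"
    proof -
      have "0 < b0 / sqrt (T N)" "0 < b0 / sqrt N" "0 < \<rho> ^ T (T N)"
        using \<open>b0 > 0\<close> \<rho> T_pos elim by auto
      moreover have "ln (b0 / sqrt (T N)) = ln b0 - 1 / 2 * ln (real (T N))"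
        "ln (b0 / sqrt N) = ln b0 - 1 / 2 * ln (real N)"
        using \<open>b0 > 0\<close> T_pos elim by (simp_all add: ln_div ln_sqrt)
      moreover have "ln (u * v * w) = ln u + ln v + ln w" if "0 < u" "0 < v" "0 < w" for u v w :: real
        using that by (simp add: ln_mult)
      ultimately show ?thesis using \<rho> by (simp only: ln_realpow)
    qed
    moreover have "(b * ln (ln (real N))) powr b * ln \<rho> \<le> real (T (T N)) * ln \<rho>"
    proof (rule mult_right_mono_neg)
      have "ln (real (T N)) \<le> b * ln (ln (real N))" using lnT logN by (simp add: ln_powr)
      then have "ln (real (T N)) powr b \<le> (b * ln (ln (real N))) powr b"
        using \<open>b > 0\<close> T_pos by (intro powr_mono2) auto
      then show "real (T (T N)) \<le> (b * ln (ln (real N))) powr b" using elim by linarith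
    qed (use \<rho> in simp)
    moreover note lnT
    ultimately have "2 * ln b0 - 1 / 2 * ln (ln (real N) powr b) + (b * ln (ln (real N))) powr b * ln \<rho>
        \<le> ln (ar_survival a N) + 1 / 2 * ln (real N)"
      by linarith
    moreover have "ln (ar_survival a N) / ln (real N) + 1 / 2
        = (ln (ar_survival a N) + 1 / 2 * ln (real N)) / ln (real N)"
      using logN by (simp add: add_divide_distrib)
    ultimately show ?case unfolding V_def using logN by (simp add: divide_right_mono)
  qed
  ultimately show ?thesis
    by - (rule tendsto_sandwich[OF _ _ \<open>V \<longlonglongrightarrow> 0\<close> \<open>U \<longlonglongrightarrow> 0\<close>])
qed

end

lemma ar2_eq_ar:
  assumes "a1 + a2 = 1"
  shows "ar2 a1 a2 Y n \<omega> = ar a2 n (\<lambda>i. Y (Suc i) \<omega>)"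
proof -
  have "ar2 a1 a2 Y n \<omega> = ar2 a1 a2 (\<lambda>i x. x (i - 1)) n (\<lambda>i. Y (Suc i) \<omega>)"
    by (induction n rule: induct_nat_012) auto
  moreover have "a1 = 1 - a2" using assms by simp
  ultimately show ?thesis by (simp add: ar_def)
qed

theorem theorem1p1:
  fixes M :: "'a measure" and Y :: "nat \<Rightarrow> 'a \<Rightarrow> real" and a1 a2 :: real
  assumes "prob_space M"
    and indep: "prob_space.indep_vars M (\<lambda>_. borel) Y {1..}"
    and ident: "\<And>n. n \<ge> 1 \<Longrightarrow> distr M borel (Y n) = distr M borel (Y 1)"
    and nondeg: "\<And>c. \<not> (AE \<omega> in M. Y 1 \<omega> = c)"
    and coef: "a1 + a2 = 1" "-1 < a2" "a2 \<le> 1"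
    and integr: "integrable M (Y 1)"
    and mean0: "integral\<^sup>L M (Y 1) = 0"
    and expmom: "\<exists>\<alpha>>0. integrable M (\<lambda>\<omega>. exp (\<bar>Y 1 \<omega>\<bar> powr \<alpha>))"
  shows "(\<bar>a2\<bar> < 1 \<longrightarrow>
            (\<exists>e. e \<in> o(\<lambda>_. 1) \<and>
               (\<forall>\<^sub>F N in at_top. surv_prob M (ar2 a1 a2 Y) N = real N powr (-1/2 + e N))))
       \<and> (a2 = 1 \<longrightarrow> (\<lambda>N. surv_prob M (ar2 a1 a2 Y) N) \<in> \<Theta>(\<lambda>N. 1 / real N))"
proof -
  interpret prob_space M by fact
  obtain \<alpha> where \<alpha>: "\<alpha> > 0" "integrable M (\<lambda>\<omega>. exp (\<bar>Y 1 \<omega>\<bar> powr \<alpha>))" using expmom by blast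
  have rv: "Y n \<in> borel_measurable M" if "n \<ge> 1" for n
    using indep that by (auto simp: indep_vars_def2)
  have Y1: "Y 1 \<in> borel_measurable M" by (rule rv) simp
  define \<mu> where "\<mu> = distr M borel (Y 1)"
  have "prob_space \<mu>" unfolding \<mu>_def by (rule prob_space_distr[OF Y1])
  interpret Q: real_sequence_space \<mu>
    using \<open>prob_space \<mu>\<close> by (rule real_sequence_spaceI) (simp add: \<mu>_def)
  have exp_meas: "(\<lambda>y::real. exp (\<bar>y\<bar> powr \<alpha>)) \<in> borel_measurable borel" by measurable
  have int_exp: "integrable \<mu> (\<lambda>y. exp (\<bar>y\<bar> powr \<alpha>))"
    unfolding \<mu>_def integrable_distr_eq[OF Y1 exp_meas] by (rule \<alpha>)
  obtain C where C: "\<And>y::real. y\<^sup>2 \<le> C * exp (\<bar>y\<bar> powr \<alpha>)" using square_le_exp_powr[OF \<alpha>(1)] by blast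
  interpret Q: centered_walk \<mu>
  proof
    show "integrable \<mu> (\<lambda>y. y)"
      unfolding \<mu>_def using integr by (subst integrable_distr_eq[OF Y1]) auto
    show "(\<integral>y. y \<partial>\<mu>) = 0"
      unfolding \<mu>_def using mean0 by (subst integral_distr[OF Y1]) auto
    have "(\<lambda>y. y\<^sup>2) \<in> borel_measurable \<mu>"
      unfolding measurable_cong_sets[OF Q.sets_M refl] by measurable
    then show "integrable \<mu> (\<lambda>y. y\<^sup>2)"
    proof (rule Bochner_Integration.integrable_bound[OF integrable_mult_right[OF int_exp, of C]])
      show "AE y in \<mu>. norm (y\<^sup>2) \<le> norm (C * exp (\<bar>y\<bar> powr \<alpha>))"
        using C by (intro AE_I2) (auto intro: order_trans[OF _ abs_ge_self])
    qed
    have "{y \<in> space borel. y = (0::real)} \<in> sets borel" by simp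
    then show "\<not> (AE y in \<mu>. y = 0)"
      unfolding \<mu>_def using nondeg[of 0] by (simp add: AE_distr_iff[OF Y1])
  qed
  have law: "distr M (Pi\<^sub>M UNIV (\<lambda>_. borel)) (\<lambda>\<omega> i. Y (Suc i) \<omega>) = Q.S"
  proof -
    let ?P = "Pi\<^sub>M {1::nat..} (\<lambda>_. borel) :: (nat \<Rightarrow> real) measure"
    have "distr M ?P (\<lambda>\<omega>. restrict (\<lambda>i. Y i \<omega>) {1..}) = (\<Pi>\<^sub>M i\<in>{1..}. distr M borel (Y i))"
      by (rule indep_vars_iff_distr_eq_PiM'[THEN iffD1, OF _ _ indep]) (simp_all add: rv)
    also have "\<dots> = Pi\<^sub>M {1..} (\<lambda>_. \<mu>)"
      unfolding \<mu>_def by (intro PiM_cong refl ident) simp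
    finally have joint: "distr M ?P (\<lambda>\<omega>. restrict (\<lambda>i. Y i \<omega>) {1..}) = Pi\<^sub>M {1..} (\<lambda>_. \<mu>)" .
    have Ym: "(\<lambda>\<omega>. restrict (\<lambda>i. Y i \<omega>) {1..}) \<in> M \<rightarrow>\<^sub>M ?P"
      by (rule measurable_restrict) (auto intro: rv)
    have shift: "(\<lambda>x i. x (Suc i)) \<in> ?P \<rightarrow>\<^sub>M Pi\<^sub>M UNIV (\<lambda>_. borel)"
      by (rule measurable_PiM_single') auto
    have "distr M (Pi\<^sub>M UNIV (\<lambda>_. borel)) (\<lambda>\<omega> i. Y (Suc i) \<omega>)
        = distr (distr M ?P (\<lambda>\<omega>. restrict (\<lambda>i. Y i \<omega>) {1..})) (Pi\<^sub>M UNIV (\<lambda>_. borel)) (\<lambda>x i. x (Suc i))"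
      by (subst distr_distr[OF shift Ym]) (simp add: comp_def)
    also have "\<dots> = distr (Pi\<^sub>M {1..} (\<lambda>_. \<mu>)) Q.S (\<lambda>x. restrict (\<lambda>i. x (Suc i)) UNIV)"
      unfolding joint by (rule distr_cong) (auto intro!: sets_PiM_cong)
    also have "\<dots> = Q.S"
      using distr_PiM_reindex[of "{1..}" "\<lambda>_. \<mu>" Suc UNIV] \<open>prob_space \<mu>\<close> by simp
    finally show ?thesis .
  qed
  have surv: "surv_prob M (ar2 a1 a2 Y) N = Q.ar_survival a2 N" for N
  proof -
    have meas: "(\<lambda>\<omega> i. Y (Suc i) \<omega>) \<in> M \<rightarrow>\<^sub>M Pi\<^sub>M UNIV (\<lambda>_. borel)"
      by (rule measurable_PiM_single') (auto intro: rv)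
    have sets: "{x. \<forall>n\<le>N. ar a2 n x \<le> 0} \<in> sets (Pi\<^sub>M UNIV (\<lambda>_. borel))"
      using Q.Collect_in_sets[OF Q.pred_ar_survival] by (simp cong: sets_PiM_cong)
    have "Q.ar_survival a2 N = measure M ((\<lambda>\<omega> i. Y (Suc i) \<omega>) -` {x. \<forall>n\<le>N. ar a2 n x \<le> 0} \<inter> space M)"
      unfolding Q.ar_survival_def law[symmetric] by (rule measure_distr[OF meas sets])
    also have "(\<lambda>\<omega> i. Y (Suc i) \<omega>) -` {x. \<forall>n\<le>N. ar a2 n x \<le> 0} \<inter> space M
        = {\<omega> \<in> space M. \<forall>n\<in>{1..N}. ar2 a1 a2 Y n \<omega> \<le> 0}"
    proof -
      have "(\<forall>n\<le>N. ar a2 n x \<le> 0) \<longleftrightarrow> (\<forall>n\<in>{1..N}. ar a2 n x \<le> 0)" for x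
        by (metis ar_0 atLeastAtMost_iff less_one not_less order_refl)
      then show ?thesis by (auto simp: ar2_eq_ar[OF coef(1)])
    qed
    finally show ?thesis by (simp add: surv_prob_def)
  qed
  show ?thesis
  proof (intro conjI impI)
    assume a: "\<bar>a2\<bar> < 1"
    let ?e = "\<lambda>N. ln (Q.ar_survival a2 N) / ln (real N) + 1 / 2"
    have "?e \<in> o(\<lambda>_. 1)"
      using Q.ar_survival_exponent[OF a \<alpha>(1) int_exp] by (intro smalloI_tendsto) auto
    moreover have "\<forall>\<^sub>F N in at_top. surv_prob M (ar2 a1 a2 Y) N = real N powr (-1/2 + ?e N)"
      using eventually_ge_at_top[of 2]
    proof eventually_elim
      case (elim N)
      then show ?case
        using Q.ar_survival_pos(1)[OF coef(3), of N] by (simp add: surv powr_def)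
    qed
    ultimately show "\<exists>e. e \<in> o(\<lambda>_. 1) \<and>
        (\<forall>\<^sub>F N in at_top. surv_prob M (ar2 a1 a2 Y) N = real N powr (-1/2 + e N))"
      by blast
  next
    assume "a2 = 1"
    then show "(\<lambda>N. surv_prob M (ar2 a1 a2 Y) N) \<in> \<Theta>(\<lambda>N. 1 / real N)"
      unfolding surv using Q.ar_survival_one_bigtheta by simp
  qed
qed

end
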